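(* Assume conditions (i), (ii) and (iii) of the context. Then there exist polynomials $p$ and $q$ such that for every $d\in\mathbb N$, all $\varepsilon,\varrho\in(0,1)$ and every $m\in\mathbb N$ with $m\ge p(d,\varepsilon^{-1},\varrho^{-1})$, there exist an architecture $a$ with input dimension $d$ and $R,D\in(0,\infty)$ with $\max\{P(a),R,D\}\le q(d,\varepsilon^{-1})$ such that, for $\mathcal H=\mathcal N_{a,R,D}$, $$\mathbb P\Big((v-u)^{-d}\,\|f_{d,m,\mathcal H}-f_d(\cdot,T)\|^2_{L^2([u,v]^d)}\le\varepsilon\Big)\ge1-\varrho.$$
   Context: Fix $T\in(0,\infty)$ and reals $u<v$. For each $d\in\mathbb N$: $\mu_d:\mathbb R^d\to\mathbb R^d$, $\sigma_d:\mathbb R^d\to\mathbb R^{d\times d}$ Lipschitz, $\varphi_d:\mathbb R^d\to\mathbb R$, and $f_d\in C(\mathbb R^d\times[0,T],\mathbb R)$ the solution of $\partial_tf_d(x,t)=\frac12\mathrm{Trace}(\sigma_d(x)\sigma_d(x)^{*}\nabla_x^2f_d(x,t))+\langle\mu_d(x),\nabla_xf_d(x,t)\rangle$, $f_d(x,0)=\varphi_d(x)$. On a probability space $(\Omega,\mathcal F,\mathbb P)$ with normal filtration $(\mathcal F_t)_{t\in[0,T]}$: $B$ a standard $d$-dimensional Brownian motion, $X_d:\Omega\to[u,v]^d$ uniform and $\mathcal F_0$-measurable, $S_t=X_d+\int_0^t\mu_d(S_s)ds+\int_0^t\sigma_d(S_s)dB_s$, $Y_d=S_T=(Y_{d,1},\dots,Y_{d,d})$.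 Risk $\mathcal E_d(f)=\mathbb E[(f(X_d)-\varphi_d(Y_d))^2]$; standing assumption of the paper: $\mathcal E_d$ is real-valued on $\mathcal L^2([u,v]^d)$ and $f_d(\cdot,T)|_{[u,v]^d}$ minimizes it there. $(\mathbf x_i,\mathbf y_i)_{i\ge1}$ i.i.d. copies of $(X_d,Y_d)$, $\mathcal E_{d,m}(f)=\frac1m\sum_{i=1}^m(f(\mathbf x_i)-\varphi_d(\mathbf y_i))^2$; for compact $\mathcal H\subseteq C([u,v]^d)$, $f_{d,m,\mathcal H}:\Omega\to\mathcal H$ is a measurable minimizer of $\mathcal E_{d,m}$ over $\mathcal H$. ReLU networks: architecture $a=(N_0,\dots,N_L)$, $N_0=d$, $N_L=1$; parameters $\theta=((A_l,b_l))$, $A_l\in\mathbb R^{N_l\times N_{l-1}}$, $b_l\in\mathbb R^{N_l}$; $\Phi_\theta=W_L\circ\rho\circ\cdots\circ\rho\circ W_1$, $W_l(x)=A_lx+b_l$, $\rho$ componentwise ReLU; $\|\theta\|_\infty$ maximal absolute entry; $P(a)=\sum_lN_l(N_{l-1}+1)$; $\mathcal N_{a,R}=\{\Phi_\theta|_{[u,v]^d}:\|\theta\|_\infty\le R\}$; $\mathrm{Clip}_D(x)=\min\{|x|,D\}\operatorname{sgn}(x)$; $\mathcal N_{a,R,D}=\{\mathrm{Clip}_D\circ\Phi:\Phi\in\mathcal N_{a,R}\}$. Conditions: (i) there is $c_1\in(0,\infty)$ with $\mathbb P(|Y_{d,i}|\ge t)\le2\exp\{-c_1(\log t)^2\}$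 for all $d$, $t\ge1$, $i\le d$; (ii) there are $c_2\in(0,\infty)$, $\lambda\in[2,\infty)$ with $|\varphi_d(y)|\le c_2(1+\|y\|_2^\lambda)$ for all $d$, $y$; (iii) there is a polynomial $q_0$ such that for every $d\in\mathbb N$ and $\varepsilon\in(0,1)$ there exist an architecture $a$ with input dimension $d$, $R,D\in(0,\infty)$ and $g_{d,\varepsilon}\in\mathcal N_{a,R,D}$ with $(v-u)^{-d}\|g_{d,\varepsilon}-f_d(\cdot,T)\|^2_{L^2([u,v]^d)}\le\varepsilon$ and $\max\{D,R,P(a)\}\le q_0(d,\varepsilon^{-1})$. *)

theory Defs
  imports "HOL-Probability.Probability"
begin

text \<open>Points of R^d are represented as extensional functions nat => real
  supported on {..<d} (the space of the product measure space below).\<close>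

definition Rd :: "nat \<Rightarrow> (nat \<Rightarrow> real) set" where
  "Rd d = PiE {..<d} (\<lambda>_. UNIV)"

definition cube :: "real \<Rightarrow> real \<Rightarrow> nat \<Rightarrow> (nat \<Rightarrow> real) set" where
  "cube u v d = PiE {..<d} (\<lambda>_. {u..v})"

definition borel_Rd :: "nat \<Rightarrow> (nat \<Rightarrow> real) measure" where
  "borel_Rd d = PiM {..<d} (\<lambda>_. borel)"

definition lebesgue_Rd :: "nat \<Rightarrow> (nat \<Rightarrow> real) measure" where
  "lebesgue_Rd d = PiM {..<d} (\<lambda>_. lborel)"

definition norm2 :: "nat \<Rightarrow> (nat \<Rightarrow> real) \<Rightarrow> real" where
  "norm2 d y = sqrt (\<Sum>i<d. (y i)\<^sup>2)"

definition l2err :: "real \<Rightarrow> real \<Rightarrow> nat \<Rightarrow> ((nat \<Rightarrow> real) \<Rightarrow> real) \<Rightarrow> ((nat \<Rightarrow> real) \<Rightarrow> real) \<Rightarrow> ennreal" where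
  "l2err u v d g h =
     (\<integral>\<^sup>+ x \<in> cube u v d. ennreal ((g x - h x)\<^sup>2) \<partial>lebesgue_Rd d) / ennreal ((v - u) ^ d)"

definition is_poly2 :: "(real \<Rightarrow> real \<Rightarrow> real) \<Rightarrow> bool" where
  "is_poly2 p \<longleftrightarrow> (\<exists>N (c :: nat \<Rightarrow> nat \<Rightarrow> real).
      \<forall>x y. p x y = (\<Sum>i\<le>N. \<Sum>j\<le>N. c i j * x ^ i * y ^ j))"

definition is_poly3 :: "(real \<Rightarrow> real \<Rightarrow> real \<Rightarrow> real) \<Rightarrow> bool" where
  "is_poly3 p \<longleftrightarrow> (\<exists>N (c :: nat \<Rightarrow> nat \<Rightarrow> nat \<Rightarrow> real).
      \<forall>x y z. p x y z = (\<Sum>i\<le>N. \<Sum>j\<le>N. \<Sum>k\<le>N. c i j k * x ^ i * y ^ j * z ^ k))"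

text \<open>An architecture is the list [N_0, ..., N_L] of layer widths.\<close>
definition is_arch :: "nat list \<Rightarrow> nat \<Rightarrow> bool" where
  "is_arch a d \<longleftrightarrow> length a \<ge> 2 \<and> hd a = d \<and> last a = 1 \<and> (\<forall>n \<in> set a. n \<ge> 1)"

definition num_params :: "nat list \<Rightarrow> nat" where
  "num_params a = (\<Sum>l < length a - 1. a ! (l + 1) * (a ! l + 1))"

type_synonym params = "((nat \<Rightarrow> nat \<Rightarrow> real) \<times> (nat \<Rightarrow> real)) list"

text \<open>theta = ((A_1,b_1),...,(A_L,b_L)); A_l is an N_l x N_(l-1) matrix (entries (i,j),
  i < N_l, j < N_(l-1)), b_l a vector of length N_l.\<close>
definition valid_params :: "nat list \<Rightarrow> params \<Rightarrow> bool" where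
  "valid_params a \<theta> \<longleftrightarrow> length \<theta> = length a - 1"

definition params_bounded :: "nat list \<Rightarrow> params \<Rightarrow> real \<Rightarrow> bool" where
  "params_bounded a \<theta> R \<longleftrightarrow>
     (\<forall>l < length \<theta>. \<forall>i < a ! (l + 1).
        (\<forall>j < a ! l. \<bar>fst (\<theta> ! l) i j\<bar> \<le> R) \<and> \<bar>snd (\<theta> ! l) i\<bar> \<le> R)"

definition affine :: "nat \<Rightarrow> nat \<Rightarrow> (nat \<Rightarrow> nat \<Rightarrow> real) \<Rightarrow> (nat \<Rightarrow> real) \<Rightarrow> (nat \<Rightarrow> real) \<Rightarrow> (nat \<Rightarrow> real)" where
  "affine n0 n1 A b x = (\<lambda>i. if i < n1 then (\<Sum>j<n0. A i j * x j) + b i else 0)"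

definition relu :: "(nat \<Rightarrow> real) \<Rightarrow> (nat \<Rightarrow> real)" where
  "relu y = (\<lambda>i. max 0 (y i))"

fun nn_eval :: "nat list \<Rightarrow> params \<Rightarrow> (nat \<Rightarrow> real) \<Rightarrow> (nat \<Rightarrow> real)" where
  "nn_eval (n0 # n1 # ns) [(A, b)] x = affine n0 n1 A b x"
| "nn_eval (n0 # n1 # ns) ((A, b) # \<theta>) x = nn_eval (n1 # ns) \<theta> (relu (affine n0 n1 A b x))"
| "nn_eval _ _ x = (\<lambda>_. 0)"

definition clip :: "real \<Rightarrow> real \<Rightarrow> real" where
  "clip D x = min \<bar>x\<bar> D * sgn x"

definition NN :: "real \<Rightarrow> real \<Rightarrow> nat \<Rightarrow> nat list \<Rightarrow> real \<Rightarrow> real \<Rightarrow> ((nat \<Rightarrow> real) \<Rightarrow> real) set" where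
  "NN u v d a R D = {restrict (\<lambda>x. clip D (nn_eval a \<theta> x 0)) (cube u v d) | \<theta>.
       valid_params a \<theta> \<and> params_bounded a \<theta> R}"

definition emp_risk ::
  "((nat \<Rightarrow> real) \<Rightarrow> real) \<Rightarrow> (nat \<Rightarrow> 'w \<Rightarrow> nat \<Rightarrow> real) \<Rightarrow> (nat \<Rightarrow> 'w \<Rightarrow> nat \<Rightarrow> real)
     \<Rightarrow> nat \<Rightarrow> ((nat \<Rightarrow> real) \<Rightarrow> real) \<Rightarrow> 'w \<Rightarrow> real" where
  "emp_risk \<phi> xs ys m f \<omega> = (\<Sum>i = 1..m. (f (xs i \<omega>) - \<phi> (ys i \<omega>))\<^sup>2) / real m"

end

theory Submission
  imports Defs
begin

text \<open>Minimality of \<open>f(\<cdot>,T)\<close> makes it the \<open>L\<^sup>2\<close>-projection of \<open>\<phi>(Y)\<close>, so the excess risk of any network is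
  its squared \<open>L\<^sup>2\<close> distance to \<open>f(\<cdot>,T)\<close>. As the empirical minimizer beats the approximating network of
  condition (iii) on the sample, it suffices to bound the deviation between empirical and true risk
  uniformly over the network class. The label \<open>\<phi>(Y)\<close> is clipped at a level \<open>K\<close> polynomial in
  \<open>d\<close>, \<open>1/\<epsilon>\<close>, \<open>1/\<rho>\<close>; the error this causes is at most a multiple of \<open>\<phi>(Y)\<^sup>2/K\<close>, which is controlled by
  Markov's inequality because (i) and (ii) bound the second moment of \<open>\<phi>(Y)\<close> polynomially in \<open>d\<close>.
  The clipped loss is bounded, so Hoeffding's inequality and a union bound over a net apply. Networks are
  Lipschitz in their parameters with a constant exponential in the depth, hence the logarithm of
  the size of a net on a parameter grid is polynomial.\<close>

section \<open>Covering numbers of ReLU networks\<close>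

text \<open>Condition (i) gives \<open>Y\<close> tails of log-Gaussian type and \<phi> may grow
  polynomially, so \<phi>(Y) has all moments but in general no exponential one; Hoeffding's
  inequality is therefore available only after truncation. The truncation error is paid for by
  Markov's inequality with failure probability \<rho>/2. This forces K to be proportional to
  1/\<rho> and makes the sample size polynomial, not logarithmic, in 1/\<rho>. The network class
  must not depend on \<rho>: the architecture, R and D come from condition (iii) at accuracy
  \<epsilon>/2, and \<rho> enters only through K and m. The remaining \<epsilon>/2 is shared by two
  deviations, that of the minimizer and that of the approximating network, each at most
  \<epsilon>/4. The minimizer is a random member of an uncountable class and is measurable only
  pointwise in x. Hence the good event is built from the finite net instead of the minimizer, and
  measurability of the random L2 error needs an argument of its own, resting on the Lipschitz
  continuity of networks in x.\<close>

definition params_close :: "nat list \<Rightarrow> params \<Rightarrow> params \<Rightarrow> real \<Rightarrow> bool" where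
  "params_close a \<theta> \<theta>' \<delta> \<longleftrightarrow>
     (\<forall>l < length \<theta>. \<forall>i < a ! (l + 1).
        (\<forall>j < a ! l. \<bar>fst (\<theta> ! l) i j - fst (\<theta>' ! l) i j\<bar> \<le> \<delta>) \<and>
        \<bar>snd (\<theta> ! l) i - snd (\<theta>' ! l) i\<bar> \<le> \<delta>)"

section \<open>Layerwise perturbation of networks\<close>

lemma params_bounded_Cons:
  "params_bounded (n0 # n1 # ns) ((A, b) # \<theta>) R \<longleftrightarrow>
     (\<forall>i<n1. (\<forall>j<n0. \<bar>A i j\<bar> \<le> R) \<and> \<bar>b i\<bar> \<le> R) \<and> params_bounded (n1 # ns) \<theta> R"
  by (simp add: params_bounded_def All_less_Suc2)

lemma params_close_Cons:
  "params_close (n0 # n1 # ns) ((A, b) # \<theta>) ((A', b') # \<theta>') \<delta> \<longleftrightarrow>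
     (\<forall>i<n1. (\<forall>j<n0. \<bar>A i j - A' i j\<bar> \<le> \<delta>) \<and> \<bar>b i - b' i\<bar> \<le> \<delta>) \<and>
     params_close (n1 # ns) \<theta> \<theta>' \<delta>"
  by (simp add: params_close_def All_less_Suc2)

lemma params_close_refl: "0 \<le> \<delta> \<Longrightarrow> params_close a \<theta> \<theta> \<delta>"
  by (simp add: params_close_def)

lemma num_params_Cons: "num_params (n0 # n1 # ns) = n1 * (n0 + 1) + num_params (n1 # ns)"
  unfolding num_params_def
  by (simp add: sum.lessThan_Suc_shift del: sum.lessThan_Suc)

lemma abs_affine_le:
  assumes A: "\<forall>i<n1. (\<forall>j<n0. \<bar>A i j\<bar> \<le> C) \<and> \<bar>b i\<bar> \<le> C"
    and x: "\<forall>j<n0. \<bar>x j\<bar> \<le> X" and X: "1 \<le> X" and C: "1 \<le> C" and n0: "n0 \<le> N"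
  shows "\<bar>affine n0 n1 A b x i\<bar> \<le> (real N + 1) * C * X"
proof (cases "i < n1")
  case True
  have CX: "0 \<le> C * X" using C X by simp
  have "\<bar>\<Sum>j<n0. A i j * x j\<bar> \<le> (\<Sum>j<n0. \<bar>A i j * x j\<bar>)" by (rule sum_abs)
  also have "\<dots> \<le> (\<Sum>j<n0. C * X)"
    using A x True C X by (intro sum_mono) (auto simp: abs_mult intro!: mult_mono)
  also have "\<dots> = real n0 * (C * X)" by simp
  also have "\<dots> \<le> real N * (C * X)" using n0 CX by (intro mult_right_mono) auto
  finally have 1: "\<bar>\<Sum>j<n0. A i j * x j\<bar> \<le> real N * (C * X)" .
  have "\<bar>b i\<bar> \<le> C * 1" using A True by simp
  also have "\<dots> \<le> C * X" using C X by (intro mult_left_mono) auto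
  finally have "\<bar>b i\<bar> \<le> C * X" .
  with 1 have "\<bar>(\<Sum>j<n0. A i j * x j) + b i\<bar> \<le> real N * (C * X) + C * X" by linarith
  with True show ?thesis by (simp add: affine_def algebra_simps)
next
  case False
  have "0 \<le> (real N + 1) * C * X" using C X by simp
  with False show ?thesis by (simp add: affine_def)
qed

text \<open>Write A x - A' x' as (A - A') x + A' (x - x'). The factor \<open>C\<close> in front of
  \<open>\<delta> * X\<close> is given away, using \<open>1 \<le> C\<close>, so that the growth
  factor \<open>(real N + 1) * C\<close> is the same as in \<open>abs_affine_le\<close> and the
  induction over layers closes.\<close>

lemma abs_affine_diff_le:
  assumes A': "\<forall>i<n1. (\<forall>j<n0. \<bar>A' i j\<bar> \<le> C) \<and> \<bar>b' i\<bar> \<le> C"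
    and AA': "\<forall>i<n1. (\<forall>j<n0. \<bar>A i j - A' i j\<bar> \<le> \<delta>) \<and> \<bar>b i - b' i\<bar> \<le> \<delta>"
    and x: "\<forall>j<n0. \<bar>x j\<bar> \<le> X" and xx': "\<forall>j<n0. \<bar>x j - x' j\<bar> \<le> \<Delta>"
    and X: "1 \<le> X" and C: "1 \<le> C" and n0: "n0 \<le> N" and \<delta>: "0 \<le> \<delta>" and \<Delta>: "0 \<le> \<Delta>"
  shows "\<bar>affine n0 n1 A b x i - affine n0 n1 A' b' x' i\<bar> \<le> (real N + 1) * C * (\<Delta> + \<delta> * X)"
proof (cases "i < n1")
  case True
  have t: "\<bar>A i j * x j - A' i j * x' j\<bar> \<le> \<delta> * X + C * \<Delta>" if "j < n0" for j
  proof -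
    have "A i j * x j - A' i j * x' j = (A i j - A' i j) * x j + A' i j * (x j - x' j)"
      by (simp add: algebra_simps)
    also have "\<bar>\<dots>\<bar> \<le> \<bar>A i j - A' i j\<bar> * \<bar>x j\<bar> + \<bar>A' i j\<bar> * \<bar>x j - x' j\<bar>"
      by (metis abs_mult abs_triangle_ineq)
    also have "\<dots> \<le> \<delta> * X + C * \<Delta>"
      using that True A' AA' x xx' X C \<delta> \<Delta> by (intro add_mono mult_mono) auto
    finally show ?thesis .
  qed
  have p: "0 \<le> \<delta> * X + C * \<Delta>" using X C \<delta> \<Delta> by simp
  have "\<bar>(\<Sum>j<n0. A i j * x j) - (\<Sum>j<n0. A' i j * x' j)\<bar>
      \<le> (\<Sum>j<n0. \<bar>A i j * x j - A' i j * x' j\<bar>)"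
    unfolding sum_subtractf[symmetric] by (rule sum_abs)
  also have "\<dots> \<le> (\<Sum>j<n0. \<delta> * X + C * \<Delta>)" using t by (intro sum_mono) auto
  also have "\<dots> = real n0 * (\<delta> * X + C * \<Delta>)" by simp
  also have "\<dots> \<le> real N * (\<delta> * X + C * \<Delta>)" using n0 p by (intro mult_right_mono) auto
  finally have 1: "\<bar>(\<Sum>j<n0. A i j * x j) - (\<Sum>j<n0. A' i j * x' j)\<bar>
      \<le> real N * (\<delta> * X + C * \<Delta>)" .
  have "\<bar>b i - b' i\<bar> \<le> \<delta> * 1" using AA' True by simp
  also have "\<dots> \<le> \<delta> * X" using \<delta> X by (intro mult_left_mono) auto
  also have "\<dots> \<le> \<delta> * X + C * \<Delta>" using C \<Delta> by simp
  finally have "\<bar>((\<Sum>j<n0. A i j * x j) + b i) - ((\<Sum>j<n0. A' i j * x' j) + b' i)\<bar>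
      \<le> (real N + 1) * (\<delta> * X + C * \<Delta>)"
    using 1 by (simp add: ring_distribs)
  also have "\<delta> * X + C * \<Delta> \<le> C * (\<delta> * X) + C * \<Delta>"
    using mult_right_mono[OF C, of "\<delta> * X"] \<delta> X by simp
  then have "(real N + 1) * (\<delta> * X + C * \<Delta>) \<le> (real N + 1) * (C * (\<delta> * X) + C * \<Delta>)"
    by (intro mult_left_mono) auto
  also have "\<dots> = (real N + 1) * C * (\<Delta> + \<delta> * X)" by (simp add: algebra_simps)
  finally show ?thesis using True by (simp add: affine_def)
next
  case False
  have "0 \<le> (real N + 1) * C * (\<Delta> + \<delta> * X)" using C X \<delta> \<Delta> by simp
  with False show ?thesis by (simp add: affine_def)
qed

lemma abs_relu_diff_le: "\<bar>relu x i - relu y i\<bar> \<le> \<bar>x i - y i\<bar>"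
  by (simp add: relu_def)

lemma abs_relu_le: "\<bar>relu x i\<bar> \<le> \<bar>x i\<bar>"
  by (simp add: relu_def)

text \<open>With \<open>Q = (real N + 1) * C\<close>, one layer turns the size bound
  \<open>X\<close> into \<open>Q * X\<close> and the error \<open>\<Delta>\<close> into
  \<open>Q * (\<Delta> + \<delta> * X)\<close>, while ReLU increases neither. After factoring out
  the powers of \<open>Q\<close>, every layer adds one more \<open>\<delta> * X\<close>, whence the
  factor \<open>length \<theta>\<close>. Input and parameters vary together because the parameter
  error of one layer is an input error of the next.\<close>

lemma nn_eval_perturb:
  assumes "length a = length \<theta> + 1" "length \<theta>' = length \<theta>" "\<theta> \<noteq> []"
    and "\<forall>n\<in>set a. n \<le> N" "params_bounded a \<theta> C" "params_bounded a \<theta>' C"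
    and "params_close a \<theta> \<theta>' \<delta>"
    and "\<forall>j<hd a. \<bar>x j\<bar> \<le> X" "\<forall>j<hd a. \<bar>x j - x' j\<bar> \<le> \<Delta>"
    and "1 \<le> X" and C: "1 \<le> C" and \<delta>: "0 \<le> \<delta>" and "0 \<le> \<Delta>"
  shows "\<bar>nn_eval a \<theta> x i - nn_eval a \<theta>' x' i\<bar>
     \<le> ((real N + 1) * C) ^ length \<theta> * (\<Delta> + \<delta> * real (length \<theta>) * X)"
  using assms(1-10,13)
proof (induction \<theta> arbitrary: a \<theta>' x x' X \<Delta>)
  case Nil then show ?case by simp
next
  case (Cons Ab \<theta>)
  define Q where "Q = (real N + 1) * C"
  have Q: "1 \<le> Q" using C mult_mono[of 1 "real N + 1" 1 C] by (simp add: Q_def)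
  obtain A b where Ab: "Ab = (A, b)" by (cases Ab)
  obtain A' b' \<theta>1 where \<theta>': "\<theta>' = (A', b') # \<theta>1"
    using Cons.prems by (cases \<theta>') auto
  obtain n0 n1 ns where a: "a = n0 # n1 # ns"
    using Cons.prems by (cases a; cases "tl a") auto
  note prem = Cons.prems[unfolded a Ab \<theta>' params_bounded_Cons params_close_Cons]
  have n0: "n0 \<le> N" using prem by simp
  let ?y = "affine n0 n1 A b x" and ?y' = "affine n0 n1 A' b' x'"
  have y: "\<bar>?y i\<bar> \<le> Q * X" for i
    unfolding Q_def using prem C by (intro abs_affine_le) auto
  have yy: "\<bar>?y i - ?y' i\<bar> \<le> Q * (\<Delta> + \<delta> * X)" for i
    unfolding Q_def using prem C \<delta> by (intro abs_affine_diff_le) auto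
  show ?case
  proof (cases \<theta>)
    case Nil
    then have "\<theta>1 = []" using prem by simp
    with Nil yy[of i] show ?thesis by (simp add: a Ab \<theta>' Q_def)
  next
    case (Cons t ts)
    then obtain t1 ts1 where \<theta>1: "\<theta>1 = t1 # ts1" using prem by (cases \<theta>1) auto
    have Q1: "1 \<le> Q * X" using Q prem mult_mono[of 1 Q 1 X] by simp
    have "\<bar>nn_eval (n1 # ns) \<theta> (relu ?y) i - nn_eval (n1 # ns) \<theta>1 (relu ?y') i\<bar>
        \<le> Q ^ length \<theta> * (Q * (\<Delta> + \<delta> * X) + \<delta> * real (length \<theta>) * (Q * X))"
      unfolding Q_def
    proof (rule Cons.IH)
      show "\<forall>j<hd (n1 # ns). \<bar>relu ?y j\<bar> \<le> (real N + 1) * C * X"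
        using y abs_relu_le order_trans unfolding Q_def by blast
      show "\<forall>j<hd (n1 # ns). \<bar>relu ?y j - relu ?y' j\<bar> \<le> (real N + 1) * C * (\<Delta> + \<delta> * X)"
        using yy abs_relu_diff_le order_trans unfolding Q_def by blast
      have "0 \<le> Q * (\<Delta> + \<delta> * X)" using Q prem \<delta> by simp
      then show "0 \<le> (real N + 1) * C * (\<Delta> + \<delta> * X)" by (simp add: Q_def)
      show "1 \<le> (real N + 1) * C * X" using Q1 by (simp add: Q_def)
    qed (use prem Cons in auto)
    also have "\<dots> = Q ^ Suc (length \<theta>) * (\<Delta> + \<delta> * real (Suc (length \<theta>)) * X)"
      by (simp add: algebra_simps)
    finally show ?thesis using Cons \<theta>1 by (simp add: a Ab \<theta>' Q_def)
  qed
qed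

text \<open>Rounding down to a grid that starts at \<open>-R\<close> keeps the grid inside
  \<open>{-R..R}\<close>. The net then consists of members of the class itself, as the deviation
  argument requires.\<close>

lemma interval_grid:
  assumes R: "0 \<le> R" and \<delta>: "0 < (\<delta>::real)"
  obtains G where "finite G" "G \<subseteq> {-R..R}" "real (card G) \<le> 2 * R / \<delta> + 1"
    "\<And>t. \<bar>t\<bar> \<le> R \<Longrightarrow> \<exists>g\<in>G. \<bar>t - g\<bar> \<le> \<delta>"
proof
  define K where "K = nat \<lfloor>2 * R / \<delta>\<rfloor>"
  let ?f = "\<lambda>k::nat. - R + real k * \<delta>"
  have K: "real K \<le> 2 * R / \<delta>" using R \<delta> by (simp add: K_def)
  show "finite (?f ` {..K})" by simp
  show "?f ` {..K} \<subseteq> {-R..R}"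
  proof safe
    fix k assume "k \<le> K"
    then have "real k \<le> 2 * R / \<delta>" using K by linarith
    then have "real k * \<delta> \<le> 2 * R" using \<delta> by (simp add: field_simps)
    then show "?f k \<in> {-R..R}" using \<delta> by simp
  qed
  have "real (card (?f ` {..K})) \<le> real (card {..K})"
    by (intro of_nat_mono card_image_le) simp
  then show "real (card (?f ` {..K})) \<le> 2 * R / \<delta> + 1" using K by simp
  fix t :: real assume t: "\<bar>t\<bar> \<le> R"
  define k where "k = nat \<lfloor>(t + R) / \<delta>\<rfloor>"
  have "0 \<le> (t + R) / \<delta>" using t \<delta> by simp
  then have k: "real k \<le> (t + R) / \<delta>" "(t + R) / \<delta> < real k + 1"
    unfolding k_def by linarith+
  have "k \<le> K" unfolding k_def K_def using t \<delta>
    by (intro nat_mono floor_mono divide_right_mono) auto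
  moreover have "real k * \<delta> \<le> t + R" "t + R < (real k + 1) * \<delta>"
    using k \<delta> by (simp_all add: field_simps)
  then have "\<bar>t - ?f k\<bar> \<le> \<delta>" by (simp add: algebra_simps)
  ultimately show "\<exists>g\<in>?f ` {..K}. \<bar>t - g\<bar> \<le> \<delta>" by blast
qed

lemma params_cover:
  assumes G: "finite G" "G \<subseteq> {-R..R}" "\<And>t. \<bar>t\<bar> \<le> R \<Longrightarrow> \<exists>g\<in>G. \<bar>t - g\<bar> \<le> \<delta>"
    and a: "a \<noteq> []"
  shows "\<exists>F. finite F \<and> card F \<le> card G ^ num_params a \<and>
     (\<forall>\<theta>\<in>F. valid_params a \<theta> \<and> params_bounded a \<theta> R) \<and>
     (\<forall>\<theta>. valid_params a \<theta> \<longrightarrow> params_bounded a \<theta> R \<longrightarrow> (\<exists>\<theta>'\<in>F. params_close a \<theta> \<theta>' \<delta>))"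
  using a
proof (induction a rule: induct_list012)
  case 1 then show ?case by simp
next
  case (2 n)
  show ?case
    by (rule exI[of _ "{[]}"])
      (auto simp: valid_params_def params_bounded_def params_close_def num_params_def)
next
  case (3 n0 n1 ns)
  obtain F where F: "finite F" "card F \<le> card G ^ num_params (n1 # ns)"
    "\<And>\<theta>. \<theta> \<in> F \<Longrightarrow> valid_params (n1 # ns) \<theta> \<and> params_bounded (n1 # ns) \<theta> R"
    "\<And>\<theta>. valid_params (n1 # ns) \<theta> \<Longrightarrow> params_bounded (n1 # ns) \<theta> R \<Longrightarrow>
      \<exists>\<theta>'\<in>F. params_close (n1 # ns) \<theta> \<theta>' \<delta>"
    using 3 by blast
  \<comment> \<open>Weights and biases of the first layer are coded as one function on an
    \<open>n1\<close> by \<open>n0 + 1\<close> array whose last column, with index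
    \<open>n0\<close>, holds the biases. The array has as many cells as the layer has parameters,
    which yields the exponent \<open>num_params\<close>.\<close>
  define W where "W = PiE ({..<n1} \<times> {..<n0+1}) (\<lambda>_. G)"
  define dec :: "(nat \<times> nat \<Rightarrow> real) \<times> params \<Rightarrow> params"
    where "dec = (\<lambda>(w, \<theta>). (\<lambda>i j. w (i, j), \<lambda>i. w (i, n0)) # \<theta>)"
  have fW: "finite W" unfolding W_def using G by (intro finite_PiE) auto
  have cW: "card W = card G ^ (n1 * (n0 + 1))"
    unfolding W_def by (simp add: card_PiE card_cartesian_product)
  have "card (dec ` (W \<times> F)) \<le> card W * card F"
    using card_image_le[of "W \<times> F" dec] fW F(1) by (simp add: card_cartesian_product)
  also have "\<dots> \<le> card G ^ num_params (n0 # n1 # ns)"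
    using F(2) by (simp add: cW num_params_Cons power_add)
  finally have "card (dec ` (W \<times> F)) \<le> card G ^ num_params (n0 # n1 # ns)" .
  moreover have "finite (dec ` (W \<times> F))" using fW F(1) by simp
  moreover have "valid_params (n0 # n1 # ns) \<theta> \<and> params_bounded (n0 # n1 # ns) \<theta> R"
    if "\<theta> \<in> dec ` (W \<times> F)" for \<theta>
  proof -
    obtain w \<theta>1 where w: "w \<in> W" "\<theta>1 \<in> F" and \<theta>: "\<theta> = dec (w, \<theta>1)" using \<open>\<theta> \<in> _\<close> by auto
    have "\<bar>w (i, j)\<bar> \<le> R" if "i < n1" "j < n0 + 1" for i j
    proof -
      have "w (i, j) \<in> G" using w(1) that unfolding W_def by (auto dest: PiE_mem)
      then show ?thesis using G(2) by (auto simp: abs_le_iff)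
    qed
    then show ?thesis using F(3)[OF w(2)]
      by (simp add: \<theta> dec_def params_bounded_Cons valid_params_def)
  qed
  moreover have "\<exists>\<theta>'\<in>dec ` (W \<times> F). params_close (n0 # n1 # ns) \<theta> \<theta>' \<delta>"
    if \<theta>: "valid_params (n0 # n1 # ns) \<theta>" "params_bounded (n0 # n1 # ns) \<theta> R" for \<theta>
  proof -
    obtain A b \<theta>1 where \<theta>1: "\<theta> = (A, b) # \<theta>1"
      using \<theta>(1) by (cases \<theta>) (auto simp: valid_params_def)
    obtain \<theta>' where \<theta>': "\<theta>' \<in> F" "params_close (n1 # ns) \<theta>1 \<theta>' \<delta>"
      using F(4)[of \<theta>1] \<theta> by (auto simp: \<theta>1 params_bounded_Cons valid_params_def)
    let ?e = "\<lambda>(i, j). if j = n0 then b i else A i j"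
    have "\<exists>g\<in>G. \<bar>?e ij - g\<bar> \<le> \<delta>" if "ij \<in> {..<n1} \<times> {..<n0+1}" for ij
      using G(3)[of "?e ij"] that \<theta>(2) by (force simp: \<theta>1 params_bounded_Cons less_Suc_eq)
    then have "\<forall>ij\<in>{..<n1} \<times> {..<n0+1}. \<exists>g. g \<in> G \<and> \<bar>?e ij - g\<bar> \<le> \<delta>" by blast
    from bchoice[OF this] obtain w
      where "\<forall>ij\<in>{..<n1} \<times> {..<n0+1}. w ij \<in> G \<and> \<bar>?e ij - w ij\<bar> \<le> \<delta>" ..
    note w = bspec[OF this]
    define w' where "w' = restrict w ({..<n1} \<times> {..<n0+1})"
    have "w' \<in> W" unfolding w'_def W_def using w by auto
    moreover have "\<bar>A i j - w' (i, j)\<bar> \<le> \<delta>" if "i < n1" "j < n0" for i j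
      using w[of "(i, j)"] that by (simp add: w'_def)
    moreover have "\<bar>b i - w' (i, n0)\<bar> \<le> \<delta>" if "i < n1" for i
      using w[of "(i, n0)"] that by (simp add: w'_def)
    ultimately have "params_close (n0 # n1 # ns) \<theta> (dec (w', \<theta>')) \<delta>"
      using \<theta>' by (simp add: \<theta>1 dec_def params_close_Cons)
    moreover have "dec (w', \<theta>') \<in> dec ` (W \<times> F)" using \<open>w' \<in> W\<close> \<theta>'(1) by blast
    ultimately show ?thesis by blast
  qed
  ultimately show ?case by blast
qed

text \<open>The input is a general family \<open>g z\<close> with measurable coordinates, so that
  the induction hypothesis applies to the output of a hidden layer.\<close>

lemma nn_eval_measurable:
  assumes "length a = length \<theta> + 1" "\<theta> \<noteq> []" "\<And>j. j < hd a \<Longrightarrow> (\<lambda>z. g z j) \<in> borel_measurable N"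
  shows "(\<lambda>z. nn_eval a \<theta> (g z) i) \<in> borel_measurable N"
  using assms
proof (induction \<theta> arbitrary: a g)
  case Nil then show ?case by simp
next
  case (Cons Ab \<theta>)
  obtain A b where Ab: "Ab = (A, b)" by (cases Ab)
  obtain n0 n1 ns where a: "a = n0 # n1 # ns"
    using Cons.prems by (cases a; cases "tl a") auto
  have [measurable]: "\<And>j. j < n0 \<Longrightarrow> (\<lambda>z. g z j) \<in> borel_measurable N"
    using Cons.prems by (simp add: a)
  have m[measurable]: "(\<lambda>z. affine n0 n1 A b (g z) j) \<in> borel_measurable N" for j
    by (cases "j < n1") (simp_all add: affine_def)
  have "(\<lambda>z. nn_eval (n1 # ns) \<theta> (relu (affine n0 n1 A b (g z))) i) \<in> borel_measurable N"
    if "\<theta> \<noteq> []"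
  proof (rule Cons.IH)
    show "(\<lambda>z. relu (affine n0 n1 A b (g z)) j) \<in> borel_measurable N" for j
      unfolding relu_def by measurable
  qed (use Cons.prems that a in auto)
  then show ?case using m by (cases \<theta>) (simp_all add: a Ab)
qed

section \<open>Clipping and its error\<close>

lemma abs_clip_le: "0 \<le> D \<Longrightarrow> \<bar>clip D x\<bar> \<le> D"
  by (auto simp: clip_def abs_mult sgn_if)

lemma abs_clip_diff_le: "0 \<le> D \<Longrightarrow> \<bar>clip D x - clip D y\<bar> \<le> \<bar>x - y\<bar>"
  by (auto simp: clip_def sgn_if min_def)

lemma clip_measurable [measurable]: "clip D \<in> borel_measurable borel"
  unfolding clip_def by measurable

text \<open>The error vanishes unless \<open>\<bar>x\<bar>\<close> exceeds \<open>K\<close>, and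
  there \<open>\<bar>x\<bar> \<le> x^2 / K\<close>. This is what turns truncation errors into second
  moments.\<close>

lemma abs_diff_clip_le:
  assumes "0 < K" shows "\<bar>x - clip K x\<bar> \<le> x\<^sup>2 / K"
proof (cases "\<bar>x\<bar> \<le> K")
  case True then show ?thesis using assms by (simp add: clip_def abs_sgn[symmetric] abs_mult_sgn)
next
  case False
  have "\<bar>x - clip K x\<bar> \<le> \<bar>x\<bar>" using False assms by (auto simp: clip_def sgn_if)
  also have "\<dots> \<le> \<bar>x\<bar> * (\<bar>x\<bar> / K)" using False assms mult_left_mono[of 1 "\<bar>x\<bar> / K" "\<bar>x\<bar>"] by simp
  finally show ?thesis by (simp add: power2_eq_square flip: abs_mult)
qed

section \<open>Uniform deviation and projection\<close>

text \<open>The squared loss minus \<open>(\<psi> z)\<^sup>2\<close>: the term common to all candidates cancels in the comparison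
  of two risks, and what remains is only linear in the unbounded \<open>\<psi>\<close>.\<close>

definition sq_excess :: "('z \<Rightarrow> real) \<Rightarrow> ('z \<Rightarrow> real) \<Rightarrow> 'z \<Rightarrow> real" where
  "sq_excess \<psi> g z = (g z)\<^sup>2 - 2 * g z * \<psi> z"

lemma sq_excess_measurable:
  assumes [measurable]: "\<psi> \<in> borel_measurable N" "g \<in> borel_measurable N"
  shows "sq_excess \<psi> g \<in> borel_measurable N"
  unfolding sq_excess_def by measurable

lemma abs_sq_excess_le:
  assumes "\<bar>g z\<bar> \<le> D" "\<bar>\<psi> z\<bar> \<le> K"
  shows "\<bar>sq_excess \<psi> g z\<bar> \<le> D\<^sup>2 + 2 * D * K"
proof -
  have "\<bar>(g z)\<^sup>2\<bar> \<le> D\<^sup>2" using power_mono[OF assms(1), of 2] by simp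
  moreover have "\<bar>2 * g z * \<psi> z\<bar> \<le> 2 * D * K"
    using assms mult_mono[of "\<bar>g z\<bar>" D "\<bar>\<psi> z\<bar>" K] by (simp add: abs_mult)
  ultimately show ?thesis unfolding sq_excess_def by linarith
qed

text \<open>The label is clipped first, at fixed \<open>g\<close>; only then is \<open>g\<close>
  replaced by \<open>h\<close>. In this order the net error \<open>\<eta>\<close> meets the bounded
  label only, and the unbounded one appears solely through its square divided by
  \<open>K\<close>.\<close>

lemma abs_sq_excess_clip_diff_le:
  assumes "\<bar>g z\<bar> \<le> D" "\<bar>h z\<bar> \<le> D" "\<bar>g z - h z\<bar> \<le> \<eta>" "0 < K"
  shows "\<bar>sq_excess \<phi> g z - sq_excess (\<lambda>z. clip K (\<phi> z)) h z\<bar>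
    \<le> 2 * D * ((\<phi> z)\<^sup>2 / K) + 2 * \<eta> * (D + K)"
proof -
  let ?\<psi> = "clip K (\<phi> z)"
  have eq: "sq_excess \<phi> g z - sq_excess (\<lambda>z. clip K (\<phi> z)) h z
     = 2 * g z * (?\<psi> - \<phi> z) + (g z - h z) * (g z + h z - 2 * ?\<psi>)"
    by (simp add: sq_excess_def power2_eq_square algebra_simps)
  have "\<bar>g z\<bar> * \<bar>?\<psi> - \<phi> z\<bar> \<le> D * ((\<phi> z)\<^sup>2 / K)"
    using assms abs_diff_clip_le[of K "\<phi> z"] by (intro mult_mono) (auto simp: abs_minus_commute)
  moreover have "\<bar>?\<psi>\<bar> \<le> K" using assms by (intro abs_clip_le) auto
  then have "\<bar>g z + h z - 2 * ?\<psi>\<bar> \<le> 2 * (D + K)" using assms(1,2) by argo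
  then have "\<bar>g z - h z\<bar> * \<bar>g z + h z - 2 * ?\<psi>\<bar> \<le> \<eta> * (2 * (D + K))"
    using assms by (intro mult_mono) auto
  moreover have "\<bar>2 * g z * (?\<psi> - \<phi> z)\<bar> = 2 * (\<bar>g z\<bar> * \<bar>?\<psi> - \<phi> z\<bar>)"
    "\<bar>(g z - h z) * (g z + h z - 2 * ?\<psi>)\<bar> = \<bar>g z - h z\<bar> * \<bar>g z + h z - 2 * ?\<psi>\<bar>"
    by (simp_all add: abs_mult)
  ultimately have "\<bar>2 * g z * (?\<psi> - \<phi> z) + (g z - h z) * (g z + h z - 2 * ?\<psi>)\<bar>
      \<le> 2 * (D * ((\<phi> z)\<^sup>2 / K)) + \<eta> * (2 * (D + K))" by linarith
  then show ?thesis unfolding eq by (simp add: mult_ac)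
qed

section \<open>Concentration of empirical risks, and orthogonality at the minimizer\<close>

context prob_space
begin

text \<open>Hoeffding's inequality for each \<open>l\<close>, then a union bound. The values lie in
  an interval of length \<open>2 * b\<close>, so the exponent 2 m s^2 / (2 b)^2 becomes m s^2 / (2
  b^2).\<close>

lemma finite_class_deviation:
  fixes Z :: "nat \<Rightarrow> 'a \<Rightarrow> 'z"
  assumes indep: "indep_vars (\<lambda>_. N) Z {1..m}" and Z0[measurable]: "Z0 \<in> M \<rightarrow>\<^sub>M N"
    and distr: "\<And>i. i \<in> {1..m} \<Longrightarrow> distr M N (Z i) = distr M N Z0"
    and F: "finite F" "\<And>l. l \<in> F \<Longrightarrow> l \<in> borel_measurable N"
      "\<And>l z. l \<in> F \<Longrightarrow> z \<in> space N \<Longrightarrow> \<bar>l z\<bar> \<le> b"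
    and b: "0 < b" and s: "0 \<le> s" and m: "1 \<le> m"
  shows "{\<omega>\<in>space M. \<exists>l\<in>F. s \<le> \<bar>(\<Sum>i=1..m. l (Z i \<omega>)) / m - expectation (\<lambda>\<omega>. l (Z0 \<omega>))\<bar>} \<in> events"
      (is "?A \<in> events")
    and "prob {\<omega>\<in>space M. \<exists>l\<in>F. s \<le> \<bar>(\<Sum>i=1..m. l (Z i \<omega>)) / m - expectation (\<lambda>\<omega>. l (Z0 \<omega>))\<bar>}
      \<le> 2 * real (card F) * exp (- (m * s\<^sup>2) / (2 * b\<^sup>2))"
proof -
  have Zm: "Z i \<in> M \<rightarrow>\<^sub>M N" if "i \<in> {1..m}" for i
    using indep that unfolding indep_vars_def by blast
  define E where "E = (\<lambda>l. {\<omega>\<in>space M. s \<le> \<bar>(\<Sum>i\<in>{1..m}. l (Z i \<omega>)) / m - expectation (\<lambda>\<omega>. l (Z0 \<omega>))\<bar>})"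
  have lZ: "(\<lambda>\<omega>. l (Z i \<omega>)) \<in> borel_measurable M" if "l \<in> F" "i \<in> {1..m}" for l i
    using measurable_compose[OF Zm F(2)] that by blast
  have Ee: "E l \<in> events" if "l \<in> F" for l
  proof -
    have [measurable]: "(\<lambda>\<omega>. \<Sum>i\<in>{1..m}. l (Z i \<omega>)) \<in> borel_measurable M"
      using lZ that by (intro borel_measurable_sum) auto
    show ?thesis unfolding E_def by measurable
  qed
  have pE: "prob (E l) \<le> 2 * exp (- (m * s\<^sup>2) / (2 * b\<^sup>2))" if l: "l \<in> F" for l
  proof -
    have lm[measurable]: "l \<in> borel_measurable N" using F l by blast
    interpret H: Hoeffding_ineq_iid M "{1..m}" "\<lambda>i \<omega>. l (Z i \<omega>)" "\<lambda>\<omega>. l (Z0 \<omega>)" "-b" b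
      "expectation (\<lambda>\<omega>. l (Z0 \<omega>))"
    proof unfold_locales
      show "indep_vars (\<lambda>_. borel) (\<lambda>i \<omega>. l (Z i \<omega>)) {1..m}"
        using indep_vars_compose2[OF indep, of "\<lambda>_. l" "\<lambda>_. borel"] lm by simp
      show "distr M borel (\<lambda>\<omega>. l (Z i \<omega>)) = distr M borel (\<lambda>\<omega>. l (Z0 \<omega>))" if "i \<in> {1..m}" for i
      proof -
        have "distr M borel (\<lambda>\<omega>. l (Z i \<omega>)) = distr (distr M N (Z i)) borel l"
          using distr_distr[OF lm Zm[OF that]] by (simp add: comp_def)
        also have "\<dots> = distr M borel (\<lambda>\<omega>. l (Z0 \<omega>))"
          unfolding distr[OF that] using distr_distr[OF lm Z0] by (simp add: comp_def)
        finally show ?thesis .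
      qed
      show "AE x in M. l (Z0 x) \<in> {- b..b}"
      proof (rule AE_I2)
        fix x assume "x \<in> space M"
        then have "\<bar>l (Z0 x)\<bar> \<le> b" using F(3)[OF l] measurable_space[OF Z0] by blast
        then show "l (Z0 x) \<in> {- b..b}" by auto
      qed
    qed auto
    have "prob {\<omega>\<in>space M. s \<le> \<bar>(\<Sum>i\<in>{1..m}. l (Z i \<omega>)) / card {1..m} - expectation (\<lambda>\<omega>. l (Z0 \<omega>))\<bar>}
      \<le> 2 * exp (- 2 * real (card {1..m}) * s\<^sup>2 / (b - - b)\<^sup>2)"
      using b s m by (intro H.Hoeffding_ineq_abs_ge') auto
    moreover have "- 2 * real (card {1..m}) * s\<^sup>2 / (b - - b)\<^sup>2 = - (m * s\<^sup>2) / (2 * b\<^sup>2)"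
      using b by (simp add: field_simps power2_eq_square)
    ultimately show ?thesis unfolding E_def by (simp only: card_atLeastAtMost) simp
  qed
  have A: "?A = (\<Union>l\<in>F. E l)" unfolding E_def by auto
  show "?A \<in> events" unfolding A using F(1) Ee by blast
  have "prob ?A \<le> (\<Sum>l\<in>F. prob (E l))"
    unfolding A using F(1) Ee by (intro measure_subadditive_finite) auto
  also have "\<dots> \<le> (\<Sum>l\<in>F. 2 * exp (- (m * s\<^sup>2) / (2 * b\<^sup>2)))" by (intro sum_mono pE)
  also have "\<dots> = 2 * real (card F) * exp (- (m * s\<^sup>2) / (2 * b\<^sup>2))" by simp
  finally show "prob ?A \<le> 2 * real (card F) * exp (- (m * s\<^sup>2) / (2 * b\<^sup>2))" .
qed

text \<open>By linearity the empirical mean has the same expectation as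
  \<open>h (Z0 \<omega>)\<close>, so Markov's inequality applies to it directly. It serves for
  \<open>h\<close> the squared label, which is unbounded.\<close>

lemma empirical_mean_markov:
  fixes Z :: "nat \<Rightarrow> 'a \<Rightarrow> 'z"
  assumes Z: "\<And>i. i \<in> {1..m} \<Longrightarrow> Z i \<in> M \<rightarrow>\<^sub>M N" and Z0[measurable]: "Z0 \<in> M \<rightarrow>\<^sub>M N"
    and distr: "\<And>i. i \<in> {1..m} \<Longrightarrow> distr M N (Z i) = distr M N Z0"
    and h[measurable]: "h \<in> borel_measurable N" and nonneg: "\<And>z. 0 \<le> (h z :: real)"
    and int: "integrable M (\<lambda>\<omega>. h (Z0 \<omega>))" and S: "expectation (\<lambda>\<omega>. h (Z0 \<omega>)) \<le> S"
    and t: "0 < t" and m: "1 \<le> m"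
  shows "{\<omega>\<in>space M. t \<le> (\<Sum>i=1..m. h (Z i \<omega>)) / m} \<in> events"
    and "prob {\<omega>\<in>space M. t \<le> (\<Sum>i=1..m. h (Z i \<omega>)) / m} \<le> S / t"
proof -
  have "integrable (distr M N Z0) h" using int by (simp add: integrable_distr_eq)
  then have i: "integrable M (\<lambda>\<omega>. h (Z i \<omega>))" if "i \<in> {1..m}" for i
    using integrable_distr_eq[OF Z[OF that] h] distr[OF that] by simp
  have e: "expectation (\<lambda>\<omega>. h (Z i \<omega>)) = expectation (\<lambda>\<omega>. h (Z0 \<omega>))" if "i \<in> {1..m}" for i
    using integral_distr[OF Z[OF that] h] integral_distr[OF Z0 h] distr[OF that] by simp
  have I: "integrable M (\<lambda>\<omega>. (\<Sum>i=1..m. h (Z i \<omega>)) / m)"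
    by (intro integrable_divide Bochner_Integration.integrable_sum i)
  then have [measurable]: "(\<lambda>\<omega>. (\<Sum>i=1..m. h (Z i \<omega>)) / m) \<in> borel_measurable M" by auto
  show "{\<omega>\<in>space M. t \<le> (\<Sum>i=1..m. h (Z i \<omega>)) / m} \<in> events" by measurable
  have "expectation (\<lambda>\<omega>. (\<Sum>i=1..m. h (Z i \<omega>)) / m) = (\<Sum>i=1..m. expectation (\<lambda>\<omega>. h (Z i \<omega>))) / m"
    using i by simp
  also have "\<dots> = expectation (\<lambda>\<omega>. h (Z0 \<omega>))" using e m by simp
  finally have ex: "expectation (\<lambda>\<omega>. (\<Sum>i=1..m. h (Z i \<omega>)) / m) \<le> S" using S by simp
  have "prob {\<omega>\<in>space M. t \<le> (\<Sum>i=1..m. h (Z i \<omega>)) / m}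
      \<le> expectation (\<lambda>\<omega>. (\<Sum>i=1..m. h (Z i \<omega>)) / m) / t"
    using I t nonneg by (intro integral_Markov_inequality_measure[where A="{}"])
      (auto intro!: AE_I2 divide_nonneg_nonneg sum_nonneg)
  also have "\<dots> \<le> S / t" using ex t by (intro divide_right_mono) auto
  finally show "prob {\<omega>\<in>space M. t \<le> (\<Sum>i=1..m. h (Z i \<omega>)) / m} \<le> S / t" .
qed

lemma integrable_mult_of_square:
  assumes [measurable]: "(f :: _ \<Rightarrow> real) \<in> borel_measurable M" "(g :: _ \<Rightarrow> real) \<in> borel_measurable M"
    and "integrable M (\<lambda>x. (f x)\<^sup>2)" "integrable M (\<lambda>x. (g x)\<^sup>2)"
  shows "integrable M (\<lambda>x. f x * g x)"
proof (rule Bochner_Integration.integrable_bound)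
  show "integrable M (\<lambda>x. (f x)\<^sup>2 + (g x)\<^sup>2)" using assms by simp
  show "AE x in M. norm (f x * g x) \<le> norm ((f x)\<^sup>2 + (g x)\<^sup>2)"
  proof (rule AE_I2)
    fix x
    have "0 \<le> (\<bar>f x\<bar> - \<bar>g x\<bar>)\<^sup>2" by simp
    then have "2 * (\<bar>f x\<bar> * \<bar>g x\<bar>) \<le> (f x)\<^sup>2 + (g x)\<^sup>2" by (simp add: power2_diff)
    moreover have "0 \<le> \<bar>f x\<bar> * \<bar>g x\<bar>" by simp
    ultimately have "\<bar>f x\<bar> * \<bar>g x\<bar> \<le> (f x)\<^sup>2 + (g x)\<^sup>2" by linarith
    then show "norm (f x * g x) \<le> norm ((f x)\<^sup>2 + (g x)\<^sup>2)" by (simp add: abs_mult)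
  qed
qed measurable

lemma integrable_diff_square:
  assumes [measurable]: "(f :: _ \<Rightarrow> real) \<in> borel_measurable M" "(g :: _ \<Rightarrow> real) \<in> borel_measurable M"
    and "integrable M (\<lambda>x. (f x)\<^sup>2)" "integrable M (\<lambda>x. (g x)\<^sup>2)"
  shows "integrable M (\<lambda>x. (f x - g x)\<^sup>2)"
  using assms integrable_mult_of_square[of f g] by (simp add: power2_diff mult.assoc)

text \<open>The good event avoids two bad ones: a large deviation of some net member with clipped
  label, and an empirical second moment of \<phi> of at least \<open>t\<close>. On it, any
  \<open>g\<close> is compared with a nearby net member carrying the clipped label, once in the
  empirical mean and once in expectation. The first comparison costs \<open>2 * D * (t / K)\<close>,
  the second \<open>2 * D * (S / K)\<close>, and each costs \<open>2 * \<eta> * (D + K)\<close> for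
  the distance to the net. The event involves finitely many functions only, so it is measurable and
  serves all of \<open>H\<close> at once.\<close>

lemma truncated_uniform_deviation:
  fixes Z :: "nat \<Rightarrow> 'a \<Rightarrow> 'z" and \<phi> :: "'z \<Rightarrow> real"
  assumes indep: "indep_vars (\<lambda>_. N) Z {1..m}" and Z0[measurable]: "Z0 \<in> M \<rightarrow>\<^sub>M N"
    and distr: "\<And>i. i \<in> {1..m} \<Longrightarrow> distr M N (Z i) = distr M N Z0"
    and F: "finite F" "F \<subseteq> H"
    and H: "\<And>g. g \<in> H \<Longrightarrow> g \<in> borel_measurable N"
      "\<And>g z. g \<in> H \<Longrightarrow> \<bar>g z\<bar> \<le> D"
      "\<And>g. g \<in> H \<Longrightarrow> \<exists>g'\<in>F. \<forall>z. \<bar>g z - g' z\<bar> \<le> \<eta>"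
    and \<phi>[measurable]: "\<phi> \<in> borel_measurable N"
    and int: "integrable M (\<lambda>\<omega>. (\<phi> (Z0 \<omega>))\<^sup>2)" and S: "expectation (\<lambda>\<omega>. (\<phi> (Z0 \<omega>))\<^sup>2) \<le> S"
    and D: "0 < D" and K: "0 < K" and s: "0 \<le> s" and t: "0 < t" and m: "1 \<le> m"
  obtains E where "E \<in> events"
    "prob E \<ge> 1 - (2 * real (card F) * exp (- (m * s\<^sup>2) / (2 * (D\<^sup>2 + 2 * D * K)\<^sup>2)) + S / t)"
    "\<And>\<omega> g. \<omega> \<in> E \<Longrightarrow> g \<in> H \<Longrightarrow>
      \<bar>(\<Sum>i=1..m. sq_excess \<phi> g (Z i \<omega>)) / m - expectation (\<lambda>\<omega>. sq_excess \<phi> g (Z0 \<omega>))\<bar>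
        \<le> s + 4 * \<eta> * (D + K) + 2 * D * (t / K) + 2 * D * (S / K)"
proof
  define b where "b = D\<^sup>2 + 2 * D * K"
  define L where "L = sq_excess (\<lambda>z. clip K (\<phi> z)) ` F"
  define A1 where "A1 = {\<omega>\<in>space M. \<exists>l\<in>L. s \<le> \<bar>(\<Sum>i=1..m. l (Z i \<omega>)) / m - expectation (\<lambda>\<omega>. l (Z0 \<omega>))\<bar>}"
  define A2 where "A2 = {\<omega>\<in>space M. t \<le> (\<Sum>i=1..m. (\<phi> (Z i \<omega>))\<^sup>2) / m}"
  have Zm: "Z i \<in> M \<rightarrow>\<^sub>M N" if "i \<in> {1..m}" for i
    using indep that unfolding indep_vars_def by blast
  have b: "0 < b" unfolding b_def using D K by (simp add: add_pos_pos)
  have bnd: "\<bar>sq_excess (\<lambda>z. clip K (\<phi> z)) g z\<bar> \<le> b" if "g \<in> H" for g z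
    unfolding b_def using H(2)[OF that] abs_clip_le[of K] K by (intro abs_sq_excess_le) auto
  have meas: "sq_excess (\<lambda>z. clip K (\<phi> z)) g \<in> borel_measurable N"
    "sq_excess \<phi> g \<in> borel_measurable N" if "g \<in> H" for g
    using H(1)[OF that] by (auto intro!: sq_excess_measurable)
  have L: "finite L" "\<And>l. l \<in> L \<Longrightarrow> l \<in> borel_measurable N" "\<And>l z. l \<in> L \<Longrightarrow> z \<in> space N \<Longrightarrow> \<bar>l z\<bar> \<le> b"
    unfolding L_def using F bnd meas by auto
  have A1: "A1 \<in> events" unfolding A1_def
    by (rule finite_class_deviation(1)[where N=N and b=b]) (fact indep Z0 distr L b s m)+
  have "prob A1 \<le> 2 * real (card L) * exp (- (m * s\<^sup>2) / (2 * b\<^sup>2))"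
    unfolding A1_def
    by (rule finite_class_deviation(2)[where N=N and b=b]) (fact indep Z0 distr L b s m)+
  also have "\<dots> \<le> 2 * real (card F) * exp (- (m * s\<^sup>2) / (2 * b\<^sup>2))"
    using card_image_le[OF F(1)] by (intro mult_right_mono) (auto simp: L_def)
  finally have p1: "prob A1 \<le> 2 * real (card F) * exp (- (m * s\<^sup>2) / (2 * b\<^sup>2))" .
  have A2: "A2 \<in> events" unfolding A2_def
    by (rule empirical_mean_markov(1)[where N=N and S=S and h="\<lambda>z. (\<phi> z)\<^sup>2"])
      (use Zm distr int S t m in auto)
  have p2: "prob A2 \<le> S / t" unfolding A2_def
    by (rule empirical_mean_markov(2)[where N=N and S=S and h="\<lambda>z. (\<phi> z)\<^sup>2"])
      (use Zm distr int S t m in auto)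
  show "space M - (A1 \<union> A2) \<in> events" using A1 A2 by auto
  have "prob (A1 \<union> A2) \<le> prob A1 + prob A2" using A1 A2 by (rule measure_Un_le)
  with p1 p2 A1 A2 show "prob (space M - (A1 \<union> A2))
      \<ge> 1 - (2 * real (card F) * exp (- (m * s\<^sup>2) / (2 * (D\<^sup>2 + 2 * D * K)\<^sup>2)) + S / t)"
    by (subst prob_compl) (auto simp: b_def)
  fix \<omega> g assume \<omega>: "\<omega> \<in> space M - (A1 \<union> A2)" and g: "g \<in> H"
  obtain h where h: "h \<in> F" "\<And>z. \<bar>g z - h z\<bar> \<le> \<eta>" using H(3)[OF g] by blast
  have hH: "h \<in> H" using h F by auto
  let ?l = "sq_excess \<phi> g" and ?k = "sq_excess (\<lambda>z. clip K (\<phi> z)) h"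
  have pw: "\<bar>?l z - ?k z\<bar> \<le> 2 * D * ((\<phi> z)\<^sup>2 / K) + 2 * \<eta> * (D + K)" for z
    using H(2)[OF g] H(2)[OF hH] h(2) K by (intro abs_sq_excess_clip_diff_le) auto
  have e1: "\<bar>(\<Sum>i=1..m. ?l (Z i \<omega>)) / m - (\<Sum>i=1..m. ?k (Z i \<omega>)) / m\<bar>
      \<le> 2 * D * (t / K) + 2 * \<eta> * (D + K)"
  proof -
    have "\<bar>(\<Sum>i=1..m. ?l (Z i \<omega>)) / m - (\<Sum>i=1..m. ?k (Z i \<omega>)) / m\<bar>
        = \<bar>\<Sum>i=1..m. ?l (Z i \<omega>) - ?k (Z i \<omega>)\<bar> / m"
      by (simp add: sum_subtractf diff_divide_distrib[symmetric])
    also have "\<dots> \<le> (\<Sum>i=1..m. 2 * D * ((\<phi> (Z i \<omega>))\<^sup>2 / K) + 2 * \<eta> * (D + K)) / m"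
      using pw by (intro divide_right_mono order_trans[OF sum_abs] sum_mono) auto
    also have "\<dots> = 2 * D / K * ((\<Sum>i=1..m. (\<phi> (Z i \<omega>))\<^sup>2) / m) + 2 * \<eta> * (D + K)"
      using m by (simp add: sum.distrib add_divide_distrib sum_divide_distrib sum_distrib_left)
    also have "\<dots> \<le> 2 * D / K * t + 2 * \<eta> * (D + K)"
      using \<omega> D K by (intro add_right_mono mult_left_mono) (auto simp: A2_def)
    finally show ?thesis by simp
  qed
  have il: "integrable M (\<lambda>\<omega>. ?l (Z0 \<omega>))"
  proof -
    have gm[measurable]: "g \<in> borel_measurable N" using H g by blast
    have i1: "integrable M (\<lambda>\<omega>. (g (Z0 \<omega>))\<^sup>2)"
    proof (rule integrable_const_bound[where B="D\<^sup>2"])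
      show "AE x in M. norm ((g (Z0 x))\<^sup>2) \<le> D\<^sup>2"
        using power_mono[OF H(2)[OF g], where n=2] by (intro AE_I2) simp
    qed measurable
    have "integrable M (\<lambda>\<omega>. g (Z0 \<omega>) * \<phi> (Z0 \<omega>))"
      using i1 int by (intro integrable_mult_of_square) measurable
    then have "integrable M (\<lambda>\<omega>. (g (Z0 \<omega>))\<^sup>2 - 2 * (g (Z0 \<omega>) * \<phi> (Z0 \<omega>)))" using i1 by auto
    then show ?thesis by (simp add: sq_excess_def mult.assoc)
  qed
  have ik: "integrable M (\<lambda>\<omega>. ?k (Z0 \<omega>))"
  proof (rule integrable_const_bound[where B=b])
    show "AE x in M. norm (?k (Z0 x)) \<le> b" using bnd[OF hH] by simp
    show "(\<lambda>x. ?k (Z0 x)) \<in> borel_measurable M" using measurable_compose[OF Z0 meas(1)[OF hH]] .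
  qed
  have e2: "\<bar>expectation (\<lambda>\<omega>. ?l (Z0 \<omega>)) - expectation (\<lambda>\<omega>. ?k (Z0 \<omega>))\<bar>
      \<le> 2 * D * (S / K) + 2 * \<eta> * (D + K)"
  proof -
    have "\<bar>expectation (\<lambda>\<omega>. ?l (Z0 \<omega>)) - expectation (\<lambda>\<omega>. ?k (Z0 \<omega>))\<bar>
        = \<bar>expectation (\<lambda>\<omega>. ?l (Z0 \<omega>) - ?k (Z0 \<omega>))\<bar>" using il ik by simp
    also have "\<dots> \<le> expectation (\<lambda>\<omega>. \<bar>?l (Z0 \<omega>) - ?k (Z0 \<omega>)\<bar>)" by (rule integral_abs_bound)
    also have "\<dots> \<le> expectation (\<lambda>\<omega>. 2 * D * ((\<phi> (Z0 \<omega>))\<^sup>2 / K) + 2 * \<eta> * (D + K))"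
      using il ik int pw by (intro integral_mono) auto
    also have "\<dots> = 2 * D / K * expectation (\<lambda>\<omega>. (\<phi> (Z0 \<omega>))\<^sup>2) + 2 * \<eta> * (D + K)"
      using int by (simp add: prob_space)
    also have "\<dots> \<le> 2 * D / K * S + 2 * \<eta> * (D + K)"
      using S D K by (intro add_right_mono mult_left_mono) auto
    finally show ?thesis by simp
  qed
  have e3: "\<bar>(\<Sum>i=1..m. ?k (Z i \<omega>)) / m - expectation (\<lambda>\<omega>. ?k (Z0 \<omega>))\<bar> \<le> s"
    using \<omega> h(1) unfolding A1_def L_def by force
  have "2 * \<eta> * (D + K) + 2 * \<eta> * (D + K) = 4 * \<eta> * (D + K)" by (simp add: algebra_simps)
  then show "\<bar>(\<Sum>i=1..m. ?l (Z i \<omega>)) / m - expectation (\<lambda>\<omega>. ?l (Z0 \<omega>))\<bar>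
        \<le> s + 4 * \<eta> * (D + K) + 2 * D * (t / K) + 2 * D * (S / K)"
    using e1 e2 e3 by linarith
qed

text \<open>The risk is quadratic along the line through \<open>f\<close> and \<open>g\<close>, so minimality at \<open>f\<close> kills
  the linear term.\<close>

lemma minimizer_pythagoras:
  fixes f g \<phi> :: "'a \<Rightarrow> real"
  assumes [measurable]: "f \<in> borel_measurable M" "g \<in> borel_measurable M" "\<phi> \<in> borel_measurable M"
    and f: "integrable M (\<lambda>x. (f x)\<^sup>2)" and g: "integrable M (\<lambda>x. (g x)\<^sup>2)"
    and \<phi>: "integrable M (\<lambda>x. (\<phi> x)\<^sup>2)"
    and min: "\<And>t. expectation (\<lambda>x. (f x - \<phi> x)\<^sup>2) \<le> expectation (\<lambda>x. (f x + t * (g x - f x) - \<phi> x)\<^sup>2)"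
  shows "expectation (\<lambda>x. (g x - \<phi> x)\<^sup>2) = expectation (\<lambda>x. (f x - \<phi> x)\<^sup>2) + expectation (\<lambda>x. (g x - f x)\<^sup>2)"
proof -
  define c where "c = expectation (\<lambda>x. (g x - f x) * (f x - \<phi> x))"
  define q where "q = expectation (\<lambda>x. (g x - f x)\<^sup>2)"
  define r where "r = expectation (\<lambda>x. (f x - \<phi> x)\<^sup>2)"
  have i1: "integrable M (\<lambda>x. (g x - f x)\<^sup>2)" and i2: "integrable M (\<lambda>x. (f x - \<phi> x)\<^sup>2)"
    using f g \<phi> by (auto intro!: integrable_diff_square)
  have i3: "integrable M (\<lambda>x. (g x - f x) * (f x - \<phi> x))"
    using i1 i2 by (intro integrable_mult_of_square) measurable
  have expand: "expectation (\<lambda>x. (f x + t * (g x - f x) - \<phi> x)\<^sup>2) = r + 2 * t * c + t\<^sup>2 * q" for t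
  proof -
    have "(\<lambda>x. (f x + t * (g x - f x) - \<phi> x)\<^sup>2)
      = (\<lambda>x. (f x - \<phi> x)\<^sup>2 + 2 * t * ((g x - f x) * (f x - \<phi> x)) + t\<^sup>2 * (g x - f x)\<^sup>2)"
      by (simp add: fun_eq_iff power2_eq_square algebra_simps)
    then show ?thesis using i1 i2 i3 by (simp add: r_def c_def q_def)
  qed
  have q: "0 \<le> q" unfolding q_def by (intro integral_nonneg_AE) simp
  have "0 \<le> 2 * t * c + t\<^sup>2 * q" for t using min[of t] unfolding expand r_def[symmetric] by simp
  \<comment> \<open>The minimum of the quadratic in t is at -c/q; dividing by \<open>q + 1\<close>
    instead avoids the degenerate case q = 0 and still gives the value -(c/(q+1))^2 (q+2), which is
    nonnegative only for c = 0.\<close>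
  from this[of "- (c / (q + 1))"] have "0 \<le> - 2 * (c / (q + 1)) * c + (c / (q + 1))\<^sup>2 * q" by simp
  also have "c = c / (q + 1) * (q + 1)" using q by simp
  then have "- 2 * (c / (q + 1)) * c = - 2 * (c / (q + 1)) * (c / (q + 1) * (q + 1))" by simp
  also have "\<dots> + (c / (q + 1))\<^sup>2 * q = - ((c / (q + 1))\<^sup>2 * (q + 2))"
    unfolding power2_eq_square by (simp only: ring_distribs mult_ac) simp
  finally have "(c / (q + 1))\<^sup>2 * (q + 2) \<le> 0" by simp
  then have "c = 0" using q by (auto simp: mult_le_0_iff)
  then show ?thesis using expand[of 1] by (simp add: r_def q_def)
qed

end

section \<open>Polynomial bounds\<close>

lemma is_poly2_monomial: "is_poly2 (\<lambda>x y. A * x ^ n * y ^ n)"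
  unfolding is_poly2_def
proof (intro exI allI)
  fix x y :: real
  let ?c = "\<lambda>i j. if i = n \<and> j = n then A else 0"
  have "?c i j * x ^ i * y ^ j = (if j = n then (if i = n then A * x ^ n * y ^ n else 0) else 0)" for i j
    by simp
  then show "A * x ^ n * y ^ n = (\<Sum>i\<le>n. \<Sum>j\<le>n. ?c i j * x ^ i * y ^ j)"
    by (simp only: sum.delta[OF finite_atMost] atMost_iff order_refl if_True)
qed

lemma is_poly3_monomial: "is_poly3 (\<lambda>x y z. A * x ^ n * y ^ n * z ^ n)"
  unfolding is_poly3_def
proof (intro exI allI)
  fix x y z :: real
  let ?c = "\<lambda>i j k. if i = n \<and> j = n \<and> k = n then A else 0"
  have "?c i j k * x ^ i * y ^ j * z ^ k = (if k = n then (if j = n then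
      (if i = n then A * x ^ n * y ^ n * z ^ n else 0) else 0) else 0)" for i j k
    by simp
  then show "A * x ^ n * y ^ n * z ^ n = (\<Sum>i\<le>n. \<Sum>j\<le>n. \<Sum>k\<le>n. ?c i j k * x ^ i * y ^ j * z ^ k)"
    by (simp only: sum.delta[OF finite_atMost] atMost_iff order_refl if_True)
qed

text \<open>For arguments at least 1, such as d and 1/\<epsilon>, every power is dominated by the
  highest one. Unlike the given polynomial, the monomial rescales explicitly when its second
  argument is doubled.\<close>

lemma poly2_le_monomial:
  assumes "is_poly2 p"
  obtains A n where "0 \<le> A" "\<And>x y. 1 \<le> x \<Longrightarrow> 1 \<le> y \<Longrightarrow> p x y \<le> A * x ^ n * y ^ n"
proof -
  obtain n and c :: "nat \<Rightarrow> nat \<Rightarrow> real"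
    where p: "\<And>x y. p x y = (\<Sum>i\<le>n. \<Sum>j\<le>n. c i j * x ^ i * y ^ j)"
    using assms unfolding is_poly2_def by blast
  show ?thesis
  proof
    show "0 \<le> (\<Sum>i\<le>n. \<Sum>j\<le>n. \<bar>c i j\<bar>)" by (intro sum_nonneg) auto
    fix x y :: real assume xy: "1 \<le> x" "1 \<le> y"
    have "p x y \<le> (\<Sum>i\<le>n. \<Sum>j\<le>n. \<bar>c i j\<bar> * (x ^ n * y ^ n))"
      unfolding p
    proof (intro sum_mono)
      fix i j assume ij: "i \<in> {..n}" "j \<in> {..n}"
      have "c i j * x ^ i * y ^ j \<le> \<bar>c i j\<bar> * (x ^ i * y ^ j)"
        using xy mult_right_mono[of "c i j" "\<bar>c i j\<bar>" "x ^ i * y ^ j"] by (simp add: mult.assoc)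
      also have "\<dots> \<le> \<bar>c i j\<bar> * (x ^ n * y ^ n)"
        using xy ij by (intro mult_left_mono mult_mono power_increasing) auto
      finally show "c i j * x ^ i * y ^ j \<le> \<bar>c i j\<bar> * (x ^ n * y ^ n)" .
    qed
    also have "\<dots> = (\<Sum>i\<le>n. \<Sum>j\<le>n. \<bar>c i j\<bar>) * x ^ n * y ^ n"
      by (simp add: sum_distrib_right mult.assoc)
    finally show "p x y \<le> (\<Sum>i\<le>n. \<Sum>j\<le>n. \<bar>c i j\<bar>) * x ^ n * y ^ n" .
  qed
qed

text \<open>Stands for growth at most polynomial in d, 1/\<epsilon> and 1/\<rho>. Nonnegativity is
  part of it because upper bounds alone are not preserved by products.\<close>

definition monomial_bounded :: "(real \<Rightarrow> real \<Rightarrow> real \<Rightarrow> real) \<Rightarrow> bool" where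
  "monomial_bounded F \<longleftrightarrow> (\<exists>A n. \<forall>x y z. 1 \<le> x \<longrightarrow> 1 \<le> y \<longrightarrow> 1 \<le> z \<longrightarrow>
     0 \<le> F x y z \<and> F x y z \<le> A * (x * y * z) ^ n)"

lemma monomial_boundedI:
  assumes "\<And>x y z. 1 \<le> x \<Longrightarrow> 1 \<le> y \<Longrightarrow> 1 \<le> z \<Longrightarrow> 0 \<le> F x y z"
    and "\<And>x y z. 1 \<le> x \<Longrightarrow> 1 \<le> y \<Longrightarrow> 1 \<le> z \<Longrightarrow> F x y z \<le> A * (x * y * z) ^ n"
  shows "monomial_bounded F"
  using assms unfolding monomial_bounded_def by blast

lemma one_le_triple_prod: "1 \<le> x \<Longrightarrow> 1 \<le> y \<Longrightarrow> 1 \<le> z \<Longrightarrow> 1 \<le> x * y * (z :: real)"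
  by (metis mult_mono' mult_1 zero_le_one)

lemma monomial_bounded_const: "0 \<le> c \<Longrightarrow> monomial_bounded (\<lambda>x y z. c)"
  by (rule monomial_boundedI[where A=c and n=0]) auto

lemma monomial_bounded_vars:
  "monomial_bounded (\<lambda>x y z. x)" "monomial_bounded (\<lambda>x y z. y)" "monomial_bounded (\<lambda>x y z. z)"
proof -
  have *: "x \<le> x * y * z" "y \<le> x * y * z" "z \<le> x * y * z" if "1 \<le> x" "1 \<le> y" "1 \<le> z" for x y z :: real
  proof -
    have "1 \<le> y * z" "1 \<le> x * z" "1 \<le> x * y" using that mult_mono[of 1 _ 1] by force+
    then have "x * 1 \<le> x * (y * z)" "y * 1 \<le> y * (x * z)" "z * 1 \<le> z * (x * y)"
      using that by (intro mult_left_mono; simp)+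
    then show "x \<le> x * y * z" "y \<le> x * y * z" "z \<le> x * y * z" by (simp_all add: mult_ac)
  qed
  show "monomial_bounded (\<lambda>x y z. x)" "monomial_bounded (\<lambda>x y z. y)" "monomial_bounded (\<lambda>x y z. z)"
    by (rule monomial_boundedI[where A=1 and n=1]; simp add: *)+
qed

lemma monomial_bounded_mult:
  assumes "monomial_bounded F" "monomial_bounded G"
  shows "monomial_bounded (\<lambda>x y z. F x y z * G x y z)"
proof -
  obtain A n B k where
    F: "\<And>x y z. 1 \<le> x \<Longrightarrow> 1 \<le> y \<Longrightarrow> 1 \<le> z \<Longrightarrow> 0 \<le> F x y z \<and> F x y z \<le> A * (x * y * z) ^ n" and
    G: "\<And>x y z. 1 \<le> x \<Longrightarrow> 1 \<le> y \<Longrightarrow> 1 \<le> z \<Longrightarrow> 0 \<le> G x y z \<and> G x y z \<le> B * (x * y * z) ^ k"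
    using assms unfolding monomial_bounded_def by blast
  show ?thesis
  proof (rule monomial_boundedI[where A="A * B" and n="n + k"])
    fix x y z :: real assume *: "1 \<le> x" "1 \<le> y" "1 \<le> z"
    show "0 \<le> F x y z * G x y z" using F[OF *] G[OF *] by simp
    have "F x y z * G x y z \<le> (A * (x * y * z) ^ n) * (B * (x * y * z) ^ k)"
      using F[OF *] G[OF *] by (intro mult_mono) auto
    then show "F x y z * G x y z \<le> A * B * (x * y * z) ^ (n + k)"
      by (simp add: power_add mult_ac)
  qed
qed

lemma monomial_bounded_power:
  "monomial_bounded F \<Longrightarrow> monomial_bounded (\<lambda>x y z. F x y z ^ k)"
  by (induction k) (auto intro: monomial_bounded_const monomial_bounded_mult)

lemma monomial_bounded_add:
  assumes "monomial_bounded F" "monomial_bounded G"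
  shows "monomial_bounded (\<lambda>x y z. F x y z + G x y z)"
proof -
  obtain A n B k where
    F: "\<And>x y z. 1 \<le> x \<Longrightarrow> 1 \<le> y \<Longrightarrow> 1 \<le> z \<Longrightarrow> 0 \<le> F x y z \<and> F x y z \<le> A * (x * y * z) ^ n" and
    G: "\<And>x y z. 1 \<le> x \<Longrightarrow> 1 \<le> y \<Longrightarrow> 1 \<le> z \<Longrightarrow> 0 \<le> G x y z \<and> G x y z \<le> B * (x * y * z) ^ k"
    using assms unfolding monomial_bounded_def by blast
  have A: "0 \<le> A" and B: "0 \<le> B" using F[of 1 1 1] G[of 1 1 1] by auto
  show ?thesis
  proof (rule monomial_boundedI[where A="A + B" and n="n + k"])
    fix x y z :: real assume *: "1 \<le> x" "1 \<le> y" "1 \<le> z"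
    show "0 \<le> F x y z + G x y z" using F[OF *] G[OF *] by simp
    have "1 \<le> x * y * z" using one_le_triple_prod[OF *] .
    then have "A * (x * y * z) ^ n \<le> A * (x * y * z) ^ (n + k)"
      "B * (x * y * z) ^ k \<le> B * (x * y * z) ^ (n + k)"
      using A B by (auto intro!: mult_left_mono power_increasing)
    then show "F x y z + G x y z \<le> (A + B) * (x * y * z) ^ (n + k)"
      using F[OF *] G[OF *] by (simp add: algebra_simps)
  qed
qed

lemmas monomial_bounded_intros =
  monomial_bounded_const monomial_bounded_vars monomial_bounded_mult monomial_bounded_power
  monomial_bounded_add

section \<open>Moments\<close>

lemma log_gaussian_summable:
  assumes c: "0 < (c::real)" and r: "0 \<le> r"
  shows "summable (\<lambda>n::nat. exp (r * (real n + 1)) * (2 * exp (- c * (real n)\<^sup>2)))"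
proof (rule summable_comparison_test'[where N=0])
  let ?C = "2 * exp (r + (r + 1)\<^sup>2 / (4 * c))"
  have "summable (\<lambda>n. exp (-1::real) ^ n)" by (intro summable_geometric) simp
  then show "summable (\<lambda>n. ?C * exp (-1::real) ^ n)" by (rule summable_mult)
  fix n :: nat
  \<comment> \<open>Completing the square with \<open>r + 1\<close> in place of \<open>r\<close>
    leaves a surplus of -n in the exponent, hence a geometric majorant.\<close>
  have "0 \<le> c * (real n - (r + 1) / (2 * c))\<^sup>2" using c by simp
  also have "\<dots> = c * (real n)\<^sup>2 - (r + 1) * real n + (r + 1)\<^sup>2 / (4 * c)"
    using c by (simp add: power2_eq_square field_simps)
  finally have "r * (real n + 1) - c * (real n)\<^sup>2 \<le> (r + (r + 1)\<^sup>2 / (4 * c)) - real n"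
    by (simp add: algebra_simps)
  then have "exp (r * (real n + 1) - c * (real n)\<^sup>2) \<le> exp ((r + (r + 1)\<^sup>2 / (4 * c)) - real n)"
    by simp
  also have "\<dots> = exp (r + (r + 1)\<^sup>2 / (4 * c)) * exp (-1::real) ^ n"
    by (simp add: exp_diff exp_minus exp_of_nat_mult[symmetric] power_inverse[symmetric] field_simps)
  finally have "exp (r * (real n + 1)) * exp (- c * (real n)\<^sup>2)
      \<le> exp (r + (r + 1)\<^sup>2 / (4 * c)) * exp (-1::real) ^ n"
    by (simp add: exp_add[symmetric])
  then show "norm (exp (r * (real n + 1)) * (2 * exp (- c * (real n)\<^sup>2))) \<le> ?C * exp (-1::real) ^ n"
    by (simp add: abs_mult)
qed

text \<open>The 1 accounts for the values below 1. The n-th term accounts for the shell between exp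
  n and exp (n + 1): the largest r-th power there, times the tail bound at its lower end.\<close>

definition log_gaussian_moment :: "real \<Rightarrow> real \<Rightarrow> real" where
  "log_gaussian_moment c r = 1 + (\<Sum>n. exp (r * (real n + 1)) * (2 * exp (- c * (real n)\<^sup>2)))"

lemma log_gaussian_moment_ge_1: "0 < c \<Longrightarrow> 0 \<le> r \<Longrightarrow> 1 \<le> log_gaussian_moment c r"
  unfolding log_gaussian_moment_def using log_gaussian_summable by (simp add: suminf_nonneg)

text \<open>Decompose into the shells between consecutive powers of e. The tail at exp n is of order
  exp(-c n^2) and beats the factor exp(r (n+1)) for every \<open>r\<close>. Enlarging each shell to
  the whole tail set \<open>E n\<close> only increases the sum.\<close>

lemma (in prob_space) log_gaussian_moment_bound:
  assumes [measurable]: "V \<in> borel_measurable M" and c: "0 < c" and r: "0 \<le> r"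
    and tail: "\<And>t. 1 \<le> t \<Longrightarrow> prob {\<omega> \<in> space M. t \<le> \<bar>V \<omega>\<bar>} \<le> 2 * exp (- c * (ln t)\<^sup>2)"
  shows "(\<integral>\<^sup>+ \<omega>. ennreal (\<bar>V \<omega>\<bar> powr r) \<partial>M) \<le> ennreal (log_gaussian_moment c r)"
proof -
  define E where "E = (\<lambda>n::nat. {\<omega> \<in> space M. exp (real n) \<le> \<bar>V \<omega>\<bar>})"
  have E[measurable]: "E n \<in> events" for n unfolding E_def by measurable
  have "ennreal (\<bar>V \<omega>\<bar> powr r) \<le> 1 + (\<Sum>n. ennreal (exp (r * (real n + 1))) * indicator (E n) \<omega>)"
    if \<omega>: "\<omega> \<in> space M" for \<omega>
  proof (cases "1 \<le> \<bar>V \<omega>\<bar>")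
    case False
    then have "\<bar>V \<omega>\<bar> powr r \<le> 1" using r powr_le1[of r "\<bar>V \<omega>\<bar>"] by auto
    then have "ennreal (\<bar>V \<omega>\<bar> powr r) \<le> 1" by simp
    then show ?thesis by (intro add_increasing2) auto
  next
    case True
    define n where "n = nat \<lfloor>ln \<bar>V \<omega>\<bar>\<rfloor>"
    have "0 \<le> ln \<bar>V \<omega>\<bar>" using True by simp
    then have n: "real n \<le> ln \<bar>V \<omega>\<bar>" "ln \<bar>V \<omega>\<bar> \<le> real n + 1" unfolding n_def by linarith+
    have "exp (real n) \<le> \<bar>V \<omega>\<bar>" using n(1) True by (simp add: ln_ge_iff)
    then have "\<omega> \<in> E n" using \<omega> by (simp add: E_def)
    moreover have "\<bar>V \<omega>\<bar> powr r \<le> exp (r * (real n + 1))"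
      using True n(2) r by (auto simp: powr_def intro!: mult_left_mono)
    ultimately have "ennreal (\<bar>V \<omega>\<bar> powr r) \<le> ennreal (exp (r * (real n + 1))) * indicator (E n) \<omega>"
      by (simp add: ennreal_leI)
    also have "\<dots> \<le> (\<Sum>n. ennreal (exp (r * (real n + 1))) * indicator (E n) \<omega>)"
    proof -
      have "t n \<le> suminf t" for t :: "nat \<Rightarrow> ennreal" using sum_le_suminf[of t "{n}"] by simp
      from this[of "\<lambda>n. ennreal (exp (r * (real n + 1))) * indicator (E n) \<omega>"]
      show ?thesis .
    qed
    finally show ?thesis by (intro add_increasing) auto
  qed
  then have "(\<integral>\<^sup>+ \<omega>. ennreal (\<bar>V \<omega>\<bar> powr r) \<partial>M)
      \<le> (\<integral>\<^sup>+ \<omega>. 1 + (\<Sum>n. ennreal (exp (r * (real n + 1))) * indicator (E n) \<omega>) \<partial>M)"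
    by (intro nn_integral_mono)
  also have "\<dots> = 1 + (\<Sum>n. \<integral>\<^sup>+ \<omega>. ennreal (exp (r * (real n + 1))) * indicator (E n) \<omega> \<partial>M)"
    by (simp add: nn_integral_add nn_integral_suminf emeasure_space_1)
  also have "\<dots> = 1 + (\<Sum>n. ennreal (exp (r * (real n + 1)) * prob (E n)))"
    by (simp add: nn_integral_cmult_indicator emeasure_eq_measure ennreal_mult)
  also have "\<dots> \<le> 1 + (\<Sum>n. ennreal (exp (r * (real n + 1)) * (2 * exp (- c * (real n)\<^sup>2))))"
  proof (intro add_left_mono suminf_le ennreal_leI mult_left_mono)
    show "prob (E n) \<le> 2 * exp (- c * (real n)\<^sup>2)" for n
      using tail[of "exp (real n)"] by (simp add: E_def)
  qed auto
  also have "\<dots> = ennreal (log_gaussian_moment c r)"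
    unfolding log_gaussian_moment_def using log_gaussian_summable[OF c r]
    by (subst suminf_ennreal2) (auto simp: ennreal_plus suminf_nonneg)
  finally show ?thesis .
qed

text \<open>Passing through the largest entry \<open>k\<close> replaces a power mean inequality and
  works for all \<open>r \<ge> 0\<close>: the squared norm is at most d k^2, and a power of the
  largest entry is at most the sum of the powers of all entries.\<close>

lemma norm2_powr_le:
  assumes d: "1 \<le> d" and r: "0 \<le> r"
  shows "norm2 d y powr (2 * r) \<le> real d powr r * (\<Sum>i<d. \<bar>y i\<bar> powr (2 * r))"
proof -
  define k where "k = Max ((\<lambda>i. \<bar>y i\<bar>) ` {..<d})"
  have ne: "{..<d} \<noteq> {}" using d by (simp add: lessThan_empty_iff)
  have ky: "\<bar>y i\<bar> \<le> k" if "i < d" for i unfolding k_def using that by (intro Max_ge) auto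
  have k0: "0 \<le> k" using ky[of 0] d by linarith
  have "k \<in> (\<lambda>i. \<bar>y i\<bar>) ` {..<d}" unfolding k_def using ne by (intro Max_in) auto
  then obtain j where j: "j < d" "k = \<bar>y j\<bar>" by auto
  have "(\<Sum>i<d. (y i)\<^sup>2) \<le> (\<Sum>i<d. k\<^sup>2)"
    using power_mono[OF ky, where n=2] by (intro sum_mono) auto
  then have s: "(\<Sum>i<d. (y i)\<^sup>2) \<le> real d * k\<^sup>2" by simp
  have s0: "0 \<le> (\<Sum>i<d. (y i)\<^sup>2)" by (intro sum_nonneg) auto
  have "norm2 d y powr (2 * r) = (norm2 d y powr 2) powr r" by (simp add: powr_powr)
  also have "norm2 d y powr 2 = (\<Sum>i<d. (y i)\<^sup>2)" unfolding norm2_def using s0 by simp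
  also have "\<dots> powr r \<le> (real d * k\<^sup>2) powr r" using s s0 r by (intro powr_mono2) auto
  also have "\<dots> = real d powr r * (k powr 2) powr r" using k0 by (simp add: powr_mult)
  also have "(k powr 2) powr r = \<bar>y j\<bar> powr (2 * r)" unfolding j(2) by (rule powr_powr)
  also have "\<bar>y j\<bar> powr (2 * r) \<le> (\<Sum>i<d. \<bar>y i\<bar> powr (2 * r))"
    using j by (intro member_le_sum) auto
  finally show ?thesis by (simp add: mult_left_mono)
qed

text \<open>The real exponent \<open>lam\<close> is rounded up to a natural \<open>k\<close> so that
  the bound is a polynomial in d: the factor d^k comes from the norm estimate, the further factor d
  from summing the moments of the coordinates.\<close>

lemma (in prob_space) second_moment_bound:
  assumes d: "1 \<le> d" and Y[measurable]: "Y \<in> M \<rightarrow>\<^sub>M borel_Rd d"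
    and \<phi>m[measurable]: "\<phi> \<in> borel_measurable (borel_Rd d)"
    and int: "integrable M (\<lambda>\<omega>. (\<phi> (Y \<omega>))\<^sup>2)"
    and c1: "0 < c1" and tail: "\<And>t i. 1 \<le> t \<Longrightarrow> i < d \<Longrightarrow>
        prob {\<omega> \<in> space M. \<bar>Y \<omega> i\<bar> \<ge> t} \<le> 2 * exp (- c1 * (ln t)\<^sup>2)"
    and c2: "0 < c2" and lam: "0 \<le> lam" and k: "lam \<le> real k"
    and growth: "\<And>y. y \<in> Rd d \<Longrightarrow> \<bar>\<phi> y\<bar> \<le> c2 * (1 + norm2 d y powr lam)"
  shows "expectation (\<lambda>\<omega>. (\<phi> (Y \<omega>))\<^sup>2)
    \<le> 2 * c2\<^sup>2 * (1 + real d ^ k * real d * log_gaussian_moment c1 (2 * lam))"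
proof -
  define G where "G = log_gaussian_moment c1 (2 * lam)"
  have G: "1 \<le> G" unfolding G_def using c1 lam by (intro log_gaussian_moment_ge_1) auto
  have Ym: "(\<lambda>\<omega>. Y \<omega> i) \<in> borel_measurable M" if "i < d" for i
    using measurable_compose[OF Y[unfolded borel_Rd_def] measurable_component_singleton[of i]] that
    by simp
  have pw: "(\<phi> (Y \<omega>))\<^sup>2 \<le> 2 * c2\<^sup>2 + 2 * c2\<^sup>2 * real d ^ k * (\<Sum>i<d. \<bar>Y \<omega> i\<bar> powr (2 * lam))"
    if "\<omega> \<in> space M" for \<omega>
  proof -
    let ?n = "norm2 d (Y \<omega>) powr lam" and ?s = "\<Sum>i<d. \<bar>Y \<omega> i\<bar> powr (2 * lam)"
    have "Y \<omega> \<in> Rd d"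
      using measurable_space[OF Y that] by (simp add: borel_Rd_def Rd_def space_PiM)
    then have "(\<phi> (Y \<omega>))\<^sup>2 \<le> (c2 * (1 + ?n))\<^sup>2"
      using power_mono[OF growth, where n=2] by simp
    also have "\<dots> \<le> c2\<^sup>2 * (2 * (1 + ?n\<^sup>2))"
      unfolding power_mult_distrib using zero_le_power2[of "1 - ?n"]
      by (intro mult_left_mono) (auto simp: power2_eq_square algebra_simps)
    also have "?n\<^sup>2 = norm2 d (Y \<omega>) powr (2 * lam)"
      by (simp add: power2_eq_square powr_add[symmetric])
    finally have 1: "(\<phi> (Y \<omega>))\<^sup>2 \<le> c2\<^sup>2 * (2 * (1 + norm2 d (Y \<omega>) powr (2 * lam)))" .
    have "norm2 d (Y \<omega>) powr (2 * lam) \<le> real d powr lam * ?s" using d lam by (rule norm2_powr_le)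
    also have "real d powr lam \<le> real d powr real k" using d k by (intro powr_mono) auto
    then have "real d powr lam * ?s \<le> real d powr real k * ?s"
      by (intro mult_right_mono sum_nonneg) auto
    also have "real d powr real k = real d ^ k" using d by (simp add: powr_realpow)
    finally have "c2\<^sup>2 * (2 * (1 + norm2 d (Y \<omega>) powr (2 * lam))) \<le> c2\<^sup>2 * (2 * (1 + real d ^ k * ?s))"
      by (intro mult_left_mono) auto
    with 1 have "(\<phi> (Y \<omega>))\<^sup>2 \<le> c2\<^sup>2 * (2 * (1 + real d ^ k * ?s))" by (rule order_trans)
    then show ?thesis by (simp add: algebra_simps)
  qed
  have "ennreal (expectation (\<lambda>\<omega>. (\<phi> (Y \<omega>))\<^sup>2)) = (\<integral>\<^sup>+ \<omega>. ennreal ((\<phi> (Y \<omega>))\<^sup>2) \<partial>M)"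
    using int by (intro nn_integral_eq_integral[symmetric]) auto
  also have "\<dots> \<le> (\<integral>\<^sup>+ \<omega>. ennreal (2 * c2\<^sup>2) + ennreal (2 * c2\<^sup>2 * real d ^ k) *
      (\<Sum>i<d. ennreal (\<bar>Y \<omega> i\<bar> powr (2 * lam))) \<partial>M)"
    using ennreal_leI[OF pw]
    by (intro nn_integral_mono) (simp add: ennreal_plus ennreal_mult sum_nonneg)
  also have "\<dots> = ennreal (2 * c2\<^sup>2) + ennreal (2 * c2\<^sup>2 * real d ^ k) *
      (\<Sum>i<d. \<integral>\<^sup>+ \<omega>. ennreal (\<bar>Y \<omega> i\<bar> powr (2 * lam)) \<partial>M)"
    using Ym by (subst nn_integral_add; (subst nn_integral_cmult)?; (subst nn_integral_sum)?)
      (auto simp: emeasure_space_1)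
  also have "\<dots> \<le> ennreal (2 * c2\<^sup>2) + ennreal (2 * c2\<^sup>2 * real d ^ k) * (\<Sum>i<d. ennreal G)"
    unfolding G_def using c1 lam tail Ym
    by (intro add_left_mono mult_left_mono sum_mono log_gaussian_moment_bound) auto
  also have "\<dots> = ennreal (2 * c2\<^sup>2 * (1 + real d ^ k * real d * G))"
    using G by (simp add: ennreal_plus[symmetric] ennreal_mult[symmetric] ennreal_of_nat_eq_real_of_nat
        algebra_simps del: ennreal_plus)
  finally show ?thesis using G by (simp add: G_def)
qed

section \<open>Measurability and clipped networks\<close>

lemma sets_lebesgue_Rd: "sets (lebesgue_Rd d) = sets (borel_Rd d)"
  unfolding lebesgue_Rd_def borel_Rd_def by (rule sets_PiM_cong) auto

lemma space_borel_Rd: "space (borel_Rd d) = Rd d"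
  by (simp add: borel_Rd_def Rd_def space_PiM)

lemma cube_mem: "x \<in> cube u v d \<Longrightarrow> j < d \<Longrightarrow> x j \<in> {u..v}"
  unfolding cube_def by (erule PiE_mem) simp

lemma cube_in_sets [measurable]: "cube u v d \<in> sets (borel_Rd d)"
  unfolding cube_def borel_Rd_def by (rule sets_PiM_I_finite) auto

lemma borel_Rd_component: "i < d \<Longrightarrow> (\<lambda>x. x i) \<in> borel_measurable (borel_Rd d)"
  unfolding borel_Rd_def by (rule measurable_component_singleton) simp

lemma sigma_finite_lebesgue_Rd: "sigma_finite_measure (lebesgue_Rd d)"
proof -
  interpret product_sigma_finite "\<lambda>_::nat. lborel :: real measure" by standard
  show ?thesis unfolding lebesgue_Rd_def by (rule sigma_finite) simp
qed

lemma emeasure_cube: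
  assumes "u \<le> v" shows "emeasure (lebesgue_Rd d) (cube u v d) = ennreal ((v - u) ^ d)"
proof -
  interpret product_sigma_finite "\<lambda>_::nat. lborel :: real measure" by standard
  show ?thesis unfolding lebesgue_Rd_def cube_def using assms
    by (subst emeasure_PiM) (auto simp: ennreal_power)
qed

lemma l2err_cong:
  "(\<And>x. x \<in> cube u v d \<Longrightarrow> g x = g' x) \<Longrightarrow> l2err u v d g h = l2err u v d g' h"
  unfolding l2err_def by (intro arg_cong2[where f="(/)"] nn_integral_cong) (auto simp: indicator_def)

text \<open>Continuity refers to the topology on all sequences, whereas \<open>borel_Rd d\<close> is
  generated by the first \<open>d\<close> coordinates. The inclusion is nevertheless measurable,
  since on \<open>Rd d\<close> every other coordinate is constantly
  \<open>undefined\<close>.\<close>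

lemma continuous_imp_borel_Rd_measurable:
  fixes h :: "(nat \<Rightarrow> real) \<Rightarrow> real"
  assumes "continuous_on (Rd d) h"
  shows "h \<in> borel_measurable (borel_Rd d)"
proof -
  have "(\<lambda>x. x) \<in> borel_Rd d \<rightarrow>\<^sub>M (PiM UNIV (\<lambda>_. borel) :: (nat \<Rightarrow> real) measure)"
  proof (rule measurable_PiM_single')
    fix i :: nat
    show "(\<lambda>x. x i) \<in> borel_measurable (borel_Rd d)"
    proof (cases "i < d")
      case True then show ?thesis by (rule borel_Rd_component)
    next
      case False
      have "(\<lambda>x. undefined :: real) \<in> borel_measurable (borel_Rd d)" by simp
      then show ?thesis
        by (subst measurable_cong[where g="\<lambda>x. undefined"])
          (use False in \<open>auto simp: space_borel_Rd Rd_def PiE_def extensional_def\<close>)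
    qed
  qed (auto simp: space_PiM)
  then have "(\<lambda>x. x) \<in> borel_Rd d \<rightarrow>\<^sub>M (borel :: (nat \<Rightarrow> real) measure)"
    using measurable_cong_sets[OF refl sets_PiM_equal_borel] by blast
  then have "(\<lambda>x. x) \<in> borel_Rd d \<rightarrow>\<^sub>M restrict_space borel (Rd d)"
    by (intro measurable_restrict_space2) (auto simp: space_borel_Rd)
  from measurable_compose[OF this borel_measurable_continuous_on_restrict[OF assms]]
  show ?thesis .
qed

text \<open>A function measurable in \<open>\<omega>\<close> and continuous in \<open>x\<close> is jointly measurable, as the limit of
  its compositions with the roundings of \<open>x\<close> to a countable grid inside the cube.\<close>

lemma l2err_caratheodory_measurable:
  fixes e :: "'w \<Rightarrow> (nat \<Rightarrow> real) \<Rightarrow> real"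
  assumes meas: "\<And>x. x \<in> cube u v d \<Longrightarrow> (\<lambda>\<omega>. e \<omega> x) \<in> borel_measurable M"
    and lip: "\<And>\<omega>. \<omega> \<in> space M \<Longrightarrow> \<exists>C. \<forall>x\<in>cube u v d. \<forall>x'\<in>cube u v d. \<forall>\<Delta>\<ge>0.
        (\<forall>j<d. \<bar>x j - x' j\<bar> \<le> \<Delta>) \<longrightarrow> \<bar>e \<omega> x - e \<omega> x'\<bar> \<le> C * \<Delta>"
    and h: "h \<in> borel_measurable (borel_Rd d)"
  shows "(\<lambda>\<omega>. l2err u v d (e \<omega>) h) \<in> borel_measurable M"
proof -
  let ?L = "lebesgue_Rd d"
  have cL[measurable]: "cube u v d \<in> sets ?L" by (simp add: sets_lebesgue_Rd cube_in_sets)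
  have hL[measurable]: "h \<in> borel_measurable ?L"
    using h by (simp add: measurable_cong_sets[OF sets_lebesgue_Rd refl])
  have comp[measurable]: "(\<lambda>x. x i) \<in> borel_measurable ?L" if "i < d" for i
    using borel_Rd_component[OF that] by (simp add: measurable_cong_sets[OF sets_lebesgue_Rd refl])
  define I where "I = PiE {..<d} (\<lambda>_. UNIV :: int set)"
  have cI: "countable I" unfolding I_def by (intro countable_PiE) auto
  \<comment> \<open>The grid starts at \<open>u\<close> and coordinates are rounded down, so for x
    in the cube the rounded point lies between \<open>u\<close> and x in each coordinate. It thus
    stays in the cube, where measurability and the Lipschitz bound of \<open>e\<close> are
    available.\<close>
  define k :: "nat \<Rightarrow> (nat \<Rightarrow> real) \<Rightarrow> nat \<Rightarrow> int"
    where "k = (\<lambda>n x. \<lambda>i\<in>{..<d}. \<lfloor>(x i - u) * (real n + 1)\<rfloor>)"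
  define dec :: "nat \<Rightarrow> (nat \<Rightarrow> int) \<Rightarrow> nat \<Rightarrow> real"
    where "dec = (\<lambda>n c. \<lambda>i\<in>{..<d}. u + real_of_int (c i) / (real n + 1))"
  have km: "k n \<in> ?L \<rightarrow>\<^sub>M count_space I" for n
  proof (subst measurable_count_space_eq_countable[OF cI], intro conjI ballI)
    show "k n \<in> space ?L \<rightarrow> I" unfolding k_def I_def by auto
    fix c assume c: "c \<in> I"
    have "k n -` {c} \<inter> space ?L = {x \<in> space ?L. \<forall>i\<in>{..<d}. \<lfloor>(x i - u) * (real n + 1)\<rfloor> = c i}"
      using c unfolding k_def I_def by (auto simp: fun_eq_iff restrict_def PiE_def extensional_def)
    also have "\<dots> \<in> sets ?L" by measurable
    finally show "k n -` {c} \<inter> space ?L \<in> sets ?L" .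
  qed
  have dec: "dec n (k n x) \<in> cube u v d" "\<forall>j<d. \<bar>dec n (k n x) j - x j\<bar> \<le> 1 / (real n + 1)"
    if x: "x \<in> cube u v d" for n x
  proof -
    have b: "u \<le> dec n (k n x) j \<and> dec n (k n x) j \<le> x j \<and> x j \<le> dec n (k n x) j + 1 / (real n + 1)"
      if j: "j < d" for j
    proof -
      let ?t = "(x j - u) * (real n + 1)"
      have xj: "u \<le> x j" using cube_mem[OF x j] by simp
      have "0 \<le> ?t" using xj by simp
      then have "0 \<le> real_of_int \<lfloor>?t\<rfloor>" "real_of_int \<lfloor>?t\<rfloor> \<le> ?t" "?t \<le> real_of_int \<lfloor>?t\<rfloor> + 1"
        using real_of_int_floor_add_one_ge[of ?t] by simp_all
      then have "0 \<le> real_of_int \<lfloor>?t\<rfloor> / (real n + 1)" "real_of_int \<lfloor>?t\<rfloor> / (real n + 1) \<le> x j - u"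
        "x j - u \<le> (real_of_int \<lfloor>?t\<rfloor> + 1) / (real n + 1)"
        by (simp_all add: pos_divide_le_eq pos_le_divide_eq)
      moreover have "dec n (k n x) j = u + real_of_int \<lfloor>?t\<rfloor> / (real n + 1)"
        using j by (simp add: dec_def k_def)
      ultimately show ?thesis by (simp add: add_divide_distrib)
    qed
    show "dec n (k n x) \<in> cube u v d"
      unfolding cube_def
    proof (rule PiE_I)
      fix j assume "j \<in> {..<d}"
      then show "dec n (k n x) j \<in> {u..v}"
        using b[of j] cube_mem[OF x, of j] by simp
    qed (simp add: dec_def)
    show "\<forall>j<d. \<bar>dec n (k n x) j - x j\<bar> \<le> 1 / (real n + 1)" using b by (fastforce simp: abs_le_iff)
  qed
  \<comment> \<open>The inner test always succeeds for x in the cube. It is there for the index-wise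
    argument: for a fixed index whose grid point leaves the cube, nothing is known about
    \<open>e\<close> at that point.\<close>
  define J where "J = (\<lambda>n z. if snd z \<in> cube u v d then
      (if dec n (k n (snd z)) \<in> cube u v d then e (fst z) (dec n (k n (snd z))) else 0) else 0)"
  have Jm: "J n \<in> borel_measurable (M \<Otimes>\<^sub>M ?L)" for n
  proof -
    have [measurable]: "(\<lambda>z. if dec n (k n (snd z)) \<in> cube u v d then e (fst z) (dec n (k n (snd z))) else 0)
        \<in> borel_measurable (M \<Otimes>\<^sub>M ?L)"
    proof (rule measurable_compose_countable'[where I=I and g="\<lambda>z. k n (snd z)" and
          f="\<lambda>c z. if dec n c \<in> cube u v d then e (fst z) (dec n c) else 0"])
      fix c
      show "(\<lambda>z. if dec n c \<in> cube u v d then e (fst z) (dec n c) else 0) \<in> borel_measurable (M \<Otimes>\<^sub>M ?L)"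
        using measurable_compose[OF measurable_fst meas, of "dec n c"] by (cases "dec n c \<in> cube u v d") auto
      show "(\<lambda>z. k n (snd z)) \<in> M \<Otimes>\<^sub>M ?L \<rightarrow>\<^sub>M count_space I"
        using measurable_compose[OF measurable_snd km] .
    qed (rule cI)
    show ?thesis unfolding J_def by measurable
  qed
  define E where "E = (\<lambda>z. if snd z \<in> cube u v d then e (fst z) (snd z) else 0)"
  have [measurable]: "E \<in> borel_measurable (M \<Otimes>\<^sub>M ?L)"
  proof (rule borel_measurable_LIMSEQ_real[OF _ Jm])
    fix z assume "z \<in> space (M \<Otimes>\<^sub>M ?L)"
    then have \<omega>: "fst z \<in> space M" by (auto simp: space_pair_measure)
    show "(\<lambda>n. J n z) \<longlonglongrightarrow> E z"
    proof (cases "snd z \<in> cube u v d")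
      case True
      obtain C where C: "\<And>x x' \<Delta>. x \<in> cube u v d \<Longrightarrow> x' \<in> cube u v d \<Longrightarrow> 0 \<le> \<Delta> \<Longrightarrow>
          \<forall>j<d. \<bar>x j - x' j\<bar> \<le> \<Delta> \<Longrightarrow> \<bar>e (fst z) x - e (fst z) x'\<bar> \<le> C * \<Delta>"
        using lip[OF \<omega>] by blast
      have "\<bar>J n z - E z\<bar> \<le> C * (1 / (real n + 1))" for n
        using C[OF dec(1)[OF True, of n] True _ dec(2)[OF True, of n]] dec(1)[OF True] True
        by (simp add: J_def E_def)
      then have ev: "\<forall>\<^sub>F n in sequentially. norm (J n z - E z) \<le> C * (1 / (real n + 1))"
        by simp
      have "(\<lambda>n. 1 / (real n + 1)) \<longlonglongrightarrow> 0"
        using LIMSEQ_inverse_real_of_nat by (simp add: inverse_eq_divide add.commute)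
      then have "(\<lambda>n. C * (1 / (real n + 1))) \<longlonglongrightarrow> 0" by (rule tendsto_mult_right_zero)
      with ev have "(\<lambda>n. J n z - E z) \<longlonglongrightarrow> 0" by (rule Lim_null_comparison)
      then show ?thesis by (simp add: LIM_zero_iff)
    next
      case False then show ?thesis by (simp add: J_def E_def)
    qed
  qed
  interpret L: sigma_finite_measure ?L by (rule sigma_finite_lebesgue_Rd)
  have "(\<lambda>\<omega>. (\<integral>\<^sup>+ x \<in> cube u v d. ennreal ((E (\<omega>, x) - h x)\<^sup>2) \<partial>?L) / ennreal ((v - u) ^ d))
      \<in> borel_measurable M"
    by measurable
  also have "(\<lambda>\<omega>. (\<integral>\<^sup>+ x \<in> cube u v d. ennreal ((E (\<omega>, x) - h x)\<^sup>2) \<partial>?L) / ennreal ((v - u) ^ d))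
     = (\<lambda>\<omega>. l2err u v d (e \<omega>) h)"
    unfolding l2err_def[symmetric] by (intro ext l2err_cong) (simp add: E_def)
  finally show ?thesis .
qed

text \<open>A layer with input width n has at least n + 1 parameters since its output width is
  positive, and the last width is 1. A single bound on the number of parameters therefore controls
  width and depth as well.\<close>

lemma arch_bounds:
  assumes "is_arch a d"
  shows "\<forall>n\<in>set a. n \<le> num_params a" "length a - 1 \<le> num_params a"
proof -
  have ge1: "1 \<le> a ! l" if "l < length a" for l using assms that by (auto simp: is_arch_def)
  have term_le: "a ! (l + 1) * (a ! l + 1) \<le> num_params a" if "l < length a - 1" for l
    unfolding num_params_def using that by (intro member_le_sum[of l "{..<length a - 1}"]) auto
  have "(\<Sum>l<length a - 1. 1) \<le> num_params a"
    unfolding num_params_def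
  proof (rule sum_mono)
    fix l assume "l \<in> {..<length a - 1}"
    then have "1 \<le> a ! (l + 1)" using ge1[of "l + 1"] by simp
    then show "1 \<le> a ! (l + 1) * (a ! l + 1)" by simp
  qed
  then show len: "length a - 1 \<le> num_params a" by simp
  show "\<forall>n\<in>set a. n \<le> num_params a"
  proof
    fix n assume "n \<in> set a"
    then obtain l where l: "l < length a" "n = a ! l" by (auto simp: in_set_conv_nth)
    show "n \<le> num_params a"
    proof (cases "l < length a - 1")
      case True
      have "1 * (a ! l + 1) \<le> a ! (l + 1) * (a ! l + 1)"
        using ge1[of "l + 1"] True by (intro mult_right_mono) auto
      then show ?thesis using term_le[OF True] l by simp
    next
      case False
      then have "l = length a - 1" using l by simp
      moreover have "a \<noteq> []" using l by auto
      ultimately have "n = 1" using assms l by (simp add: is_arch_def last_conv_nth)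
      moreover have "2 \<le> length a" using assms by (simp add: is_arch_def)
      ultimately show ?thesis using len by simp
    qed
  qed
qed

text \<open>Extending by zero instead of \<open>undefined\<close> keeps the clipping bound off the cube.\<close>

definition clipped_nn :: "real \<Rightarrow> real \<Rightarrow> nat \<Rightarrow> nat list \<Rightarrow> real \<Rightarrow> params \<Rightarrow> (nat \<Rightarrow> real) \<Rightarrow> real" where
  "clipped_nn u v d a D \<theta> x = (if x \<in> cube u v d then clip D (nn_eval a \<theta> x 0) else 0)"

definition clipped_nns :: "real \<Rightarrow> real \<Rightarrow> nat \<Rightarrow> nat list \<Rightarrow> real \<Rightarrow> real \<Rightarrow> ((nat \<Rightarrow> real) \<Rightarrow> real) set" where
  "clipped_nns u v d a R D = clipped_nn u v d a D ` {\<theta>. valid_params a \<theta> \<and> params_bounded a \<theta> R}"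

lemma NN_extend:
  assumes "g \<in> NN u v d a R D"
  obtains h where "h \<in> clipped_nns u v d a R D" "\<And>x. x \<in> cube u v d \<Longrightarrow> g x = h x"
  using assms unfolding NN_def clipped_nns_def clipped_nn_def by fastforce

lemma clipped_nns_bounded: "h \<in> clipped_nns u v d a R D \<Longrightarrow> 0 \<le> D \<Longrightarrow> \<bar>h x\<bar> \<le> D"
  unfolding clipped_nns_def clipped_nn_def using abs_clip_le by auto

lemma clipped_nns_measurable:
  assumes "h \<in> clipped_nns u v d a R D" "is_arch a d"
  shows "h \<in> borel_measurable (borel_Rd d)"
proof -
  obtain \<theta> where \<theta>: "h = clipped_nn u v d a D \<theta>" "length \<theta> = length a - 1"
    using assms by (auto simp: clipped_nns_def valid_params_def)
  have [measurable]: "(\<lambda>x. nn_eval a \<theta> x 0) \<in> borel_measurable (borel_Rd d)"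
    using assms \<theta>(2) borel_Rd_component by (intro nn_eval_measurable) (auto simp: is_arch_def)
  show ?thesis unfolding \<theta>(1) clipped_nn_def by measurable
qed

lemma params_bounded_mono: "params_bounded a \<theta> R \<Longrightarrow> R \<le> C \<Longrightarrow> params_bounded a \<theta> C"
  unfolding params_bounded_def by force

lemma clip_nn_perturb:
  assumes a: "is_arch a d" and D: "0 \<le> D"
    and \<theta>: "valid_params a \<theta>" "params_bounded a \<theta> R"
    and \<theta>': "valid_params a \<theta>'" "params_bounded a \<theta>' R"
    and close: "params_close a \<theta> \<theta>' \<delta>" and x: "x \<in> cube u v d"
    and xx': "\<forall>j<d. \<bar>x j - x' j\<bar> \<le> \<Delta>"
    and U: "1 \<le> U" "\<bar>u\<bar> \<le> U" "\<bar>v\<bar> \<le> U" and \<delta>: "0 \<le> \<delta>" and \<Delta>: "0 \<le> \<Delta>"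
  shows "\<bar>clip D (nn_eval a \<theta> x 0) - clip D (nn_eval a \<theta>' x' 0)\<bar>
    \<le> ((real (num_params a) + 1) * max R 1) ^ (length a - 1) * (\<Delta> + \<delta> * real (length a - 1) * U)"
proof -
  have L: "length \<theta> = length a - 1" using \<theta> by (simp add: valid_params_def)
  have "\<bar>nn_eval a \<theta> x 0 - nn_eval a \<theta>' x' 0\<bar>
      \<le> ((real (num_params a) + 1) * max R 1) ^ length \<theta> * (\<Delta> + \<delta> * real (length \<theta>) * U)"
  proof (rule nn_eval_perturb)
    show "\<forall>j<hd a. \<bar>x j\<bar> \<le> U"
    proof safe
      fix j assume "j < hd a"
      then have "x j \<in> {u..v}" using cube_mem[OF x] a by (simp add: is_arch_def)
      then show "\<bar>x j\<bar> \<le> U" using U by auto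
    qed
    have len: "2 \<le> length a" and hd: "hd a = d" using a by (simp_all add: is_arch_def)
    show "length a = length \<theta> + 1" "\<theta> \<noteq> []" using L len by auto
    show "length \<theta>' = length \<theta>" using L \<theta>'(1) by (simp add: valid_params_def)
    show "params_bounded a \<theta> (max R 1)" using \<theta>(2) by (rule params_bounded_mono) simp
    show "params_bounded a \<theta>' (max R 1)" using \<theta>'(2) by (rule params_bounded_mono) simp
    show "\<forall>j<hd a. \<bar>x j - x' j\<bar> \<le> \<Delta>" using xx' hd by simp
    show "\<forall>n\<in>set a. n \<le> num_params a" by (rule arch_bounds(1)[OF a])
  qed (use close U \<delta> \<Delta> in simp_all)
  then show ?thesis unfolding L[symmetric] by (rule order_trans[OF abs_clip_diff_le[OF D]])
qed

text \<open>The case of equal parameters, with \<open>\<delta> = 0\<close>: only the input moves. It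
  supplies the Lipschitz condition under which the L2 error of the random minimizer is
  measurable.\<close>

lemma NN_lipschitz:
  assumes g: "g \<in> NN u v d a R D" and a: "is_arch a d" and D: "0 \<le> D"
  shows "\<exists>C. \<forall>x\<in>cube u v d. \<forall>x'\<in>cube u v d. \<forall>\<Delta>\<ge>0.
        (\<forall>j<d. \<bar>x j - x' j\<bar> \<le> \<Delta>) \<longrightarrow> \<bar>g x - g x'\<bar> \<le> C * \<Delta>"
proof -
  obtain \<theta> where \<theta>: "g = restrict (\<lambda>x. clip D (nn_eval a \<theta> x 0)) (cube u v d)"
    "valid_params a \<theta>" "params_bounded a \<theta> R" using g by (auto simp: NN_def)
  show ?thesis
  proof (intro exI ballI allI impI)
    fix x x' and \<Delta> :: real
    assume *: "x \<in> cube u v d" "x' \<in> cube u v d" "0 \<le> \<Delta>" "\<forall>j<d. \<bar>x j - x' j\<bar> \<le> \<Delta>"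
    show "\<bar>g x - g x'\<bar> \<le> ((real (num_params a) + 1) * max R 1) ^ (length a - 1) * \<Delta>"
    proof -
      have "\<bar>clip D (nn_eval a \<theta> x 0) - clip D (nn_eval a \<theta> x' 0)\<bar>
        \<le> ((real (num_params a) + 1) * max R 1) ^ (length a - 1) *
          (\<Delta> + 0 * real (length a - 1) * (1 + \<bar>u\<bar> + \<bar>v\<bar>))"
        using a D \<theta>(2,3) \<theta>(2,3) params_close_refl[OF order_refl] *(1) *(4)
        by (rule clip_nn_perturb) (use *(3) in simp_all)
      then show ?thesis using *(1,2) by (simp add: \<theta>(1))
    qed
  qed
qed

text \<open>The grid width \<delta> is \<eta> divided by the Lipschitz constant \<open>W\<close> of
  the network in its parameters. Although \<open>W\<close> is exponential in the depth, one grid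
  interval has at most exp(2 B^3 + 2 B^2 U/\<eta>) points, and raising this to a power of at most
  \<open>B\<close> parameters multiplies the exponent by \<open>B\<close>.\<close>

lemma clipped_nns_cover:
  assumes a: "is_arch a d" and R: "0 < R" "R \<le> B" and D: "0 < D" and B: "1 \<le> B"
    and P: "real (num_params a) \<le> B" and U: "1 \<le> U" "\<bar>u\<bar> \<le> U" "\<bar>v\<bar> \<le> U" and \<eta>: "0 < \<eta>"
  obtains F where "finite F" "F \<subseteq> clipped_nns u v d a R D"
    "real (card F) \<le> exp (2 * B ^ 4 + 2 * B ^ 3 * U / \<eta>)"
    "\<And>h. h \<in> clipped_nns u v d a R D \<Longrightarrow> \<exists>h'\<in>F. \<forall>x. \<bar>h x - h' x\<bar> \<le> \<eta>"
proof -
  define L where "L = length a - 1"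
  define Q where "Q = (real (num_params a) + 1) * max R 1"
  define W where "W = Q ^ L * (real L * U)"
  define \<delta> where "\<delta> = \<eta> / W"
  have L1: "1 \<le> L" using a by (auto simp: L_def is_arch_def)
  have LB: "real L \<le> B" using arch_bounds(2)[OF a] P unfolding L_def by linarith
  have Q1: "1 \<le> Q" unfolding Q_def using mult_mono[of 1 "real (num_params a) + 1" 1 "max R 1"] by simp
  have "Q \<le> (B + 1) * B" unfolding Q_def using P R B by (intro mult_mono) auto
  also have "\<dots> \<le> (B + B) * B" using B by (intro mult_right_mono) auto
  finally have QB: "Q \<le> 2 * B\<^sup>2" by (simp add: power2_eq_square)
  have QL: "1 \<le> Q ^ L" using Q1 by simp
  have W: "0 < W" unfolding W_def using QL L1 U by auto
  then have \<delta>: "0 < \<delta>" using \<eta> by (simp add: \<delta>_def)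
  obtain G where G: "finite G" "G \<subseteq> {-R..R}" "real (card G) \<le> 2 * R / \<delta> + 1"
    "\<And>t. \<bar>t\<bar> \<le> R \<Longrightarrow> \<exists>g\<in>G. \<bar>t - g\<bar> \<le> \<delta>"
    using interval_grid[of R \<delta>] R \<delta> by auto
  have "a \<noteq> []" using a by (auto simp: is_arch_def)
  from params_cover[OF G(1,2,4) this] obtain T where T: "finite T" "card T \<le> card G ^ num_params a"
    "\<And>\<theta>. \<theta> \<in> T \<Longrightarrow> valid_params a \<theta> \<and> params_bounded a \<theta> R"
    "\<And>\<theta>. valid_params a \<theta> \<Longrightarrow> params_bounded a \<theta> R \<Longrightarrow> \<exists>\<theta>'\<in>T. params_close a \<theta> \<theta>' \<delta>"
    by blast
  have cG: "real (card G) \<le> exp (2 * B ^ 3 + 2 * B\<^sup>2 * U / \<eta>)"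
  proof -
    have "R * (real L * U) \<le> B * (B * U)" using R LB U B by (intro mult_mono) auto
    then have "2 * R * (real L * U) / \<eta> \<le> 2 * B\<^sup>2 * U / \<eta>"
      using \<eta> by (intro divide_right_mono) (auto simp: power2_eq_square)
    then have *: "2 * R * (real L * U) / \<eta> + 1 \<le> exp (2 * B\<^sup>2 * U / \<eta>)"
      using exp_ge_add_one_self[of "2 * B\<^sup>2 * U / \<eta>"] by linarith
    \<comment> \<open>The crude estimates Q \<le> exp Q and 1 + w \<le> exp w stand in for
      logarithms, so that the entropy bound is itself a polynomial expression in \<open>B\<close>,
      \<open>U\<close> and 1/\<eta>.\<close>
    have "Q \<le> exp Q" using exp_ge_add_one_self[of Q] by linarith
    then have "Q ^ L \<le> exp Q ^ L" using Q1 by (intro power_mono) auto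
    also have "\<dots> = exp (real L * Q)" by (simp add: exp_of_nat_mult)
    also have "real L * Q \<le> B * (2 * B\<^sup>2)" using LB QB Q1 B by (intro mult_mono) auto
    then have "exp (real L * Q) \<le> exp (2 * B ^ 3)" by (simp add: power2_eq_square power3_eq_cube mult_ac)
    finally have **: "Q ^ L \<le> exp (2 * B ^ 3)" .
    have "real (card G) \<le> Q ^ L * (2 * R * (real L * U) / \<eta>) + 1"
      using G(3) \<eta> by (simp add: \<delta>_def W_def mult_ac)
    also have "\<dots> \<le> Q ^ L * (2 * R * (real L * U) / \<eta> + 1)" using QL by (simp add: ring_distribs)
    also have "\<dots> \<le> exp (2 * B ^ 3) * exp (2 * B\<^sup>2 * U / \<eta>)"
      using * ** QL R U \<eta> by (intro mult_mono) auto
    finally show ?thesis by (simp add: exp_add)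
  qed
  show ?thesis
  proof
    let ?F = "clipped_nn u v d a D ` T"
    show "finite ?F" using T(1) by simp
    show "?F \<subseteq> clipped_nns u v d a R D" using T(3) by (auto simp: clipped_nns_def)
    have "card ?F \<le> card T" using T(1) by (rule card_image_le)
    also have "\<dots> \<le> card G ^ num_params a" by (rule T(2))
    finally have "real (card ?F) \<le> real (card G ^ num_params a)" by (rule of_nat_mono)
    also have "\<dots> = real (card G) ^ num_params a" by simp
    also have "\<dots> \<le> exp (2 * B ^ 3 + 2 * B\<^sup>2 * U / \<eta>) ^ num_params a" using cG by (intro power_mono) auto
    also have "\<dots> = exp (real (num_params a) * (2 * B ^ 3 + 2 * B\<^sup>2 * U / \<eta>))"
      by (simp only: exp_of_nat_mult)
    also have "\<dots> \<le> exp (B * (2 * B ^ 3 + 2 * B\<^sup>2 * U / \<eta>))"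
      using P B U \<eta> by (simp only: exp_le_cancel_iff, intro mult_right_mono) auto
    also have "B * (2 * B ^ 3 + 2 * B\<^sup>2 * U / \<eta>) = 2 * B ^ 4 + 2 * B ^ 3 * U / \<eta>"
      by (simp add: power2_eq_square power3_eq_cube power4_eq_xxxx algebra_simps)
    finally show "real (card ?F) \<le> exp (2 * B ^ 4 + 2 * B ^ 3 * U / \<eta>)" .
    fix h assume "h \<in> clipped_nns u v d a R D"
    then obtain \<theta> where \<theta>: "h = clipped_nn u v d a D \<theta>" "valid_params a \<theta>" "params_bounded a \<theta> R"
      by (auto simp: clipped_nns_def)
    obtain \<theta>' where \<theta>': "\<theta>' \<in> T" "params_close a \<theta> \<theta>' \<delta>" using T(4)[OF \<theta>(2,3)] by blast
    have "\<bar>h x - clipped_nn u v d a D \<theta>' x\<bar> \<le> \<eta>" for x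
    proof (cases "x \<in> cube u v d")
      case True
      have "\<bar>clip D (nn_eval a \<theta> x 0) - clip D (nn_eval a \<theta>' x 0)\<bar> \<le> Q ^ L * (0 + \<delta> * real L * U)"
        unfolding Q_def L_def using a D \<theta> \<theta>' T(3) True U \<delta> by (intro clip_nn_perturb[where u=u and v=v and R=R]) auto
      also have "\<dots> = \<delta> * W" by (simp add: W_def)
      also have "\<dots> = \<eta>" using W by (simp add: \<delta>_def)
      finally show ?thesis using True by (simp add: \<theta>(1) clipped_nn_def)
    next
      case False then show ?thesis using \<eta> by (simp add: \<theta>(1) clipped_nn_def)
    qed
    then show "\<exists>h'\<in>?F. \<forall>x. \<bar>h x - h' x\<bar> \<le> \<eta>" using \<theta>'(1) by blast
  qed
qed

section \<open>Empirical risk minimization\<close>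

context prob_space
begin

lemma nn_integral_uniform_cube:
  assumes X: "X \<in> M \<rightarrow>\<^sub>M borel_Rd d"
    and unif: "distr M (borel_Rd d) X = uniform_measure (lebesgue_Rd d) (cube u v d)" and uv: "u < v"
    and F: "F \<in> borel_measurable (borel_Rd d)"
  shows "(\<integral>\<^sup>+ \<omega>. F (X \<omega>) \<partial>M)
    = (\<integral>\<^sup>+ x \<in> cube u v d. F x \<partial>lebesgue_Rd d) / ennreal ((v - u) ^ d)"
proof -
  have FL: "F \<in> borel_measurable (lebesgue_Rd d)"
    using F by (simp add: measurable_cong_sets[OF sets_lebesgue_Rd refl])
  have "(\<integral>\<^sup>+ \<omega>. F (X \<omega>) \<partial>M) = (\<integral>\<^sup>+ x. F x \<partial>distr M (borel_Rd d) X)"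
    using X F by (intro nn_integral_distr[symmetric]) auto
  also have "\<dots> = (\<integral>\<^sup>+ x \<in> cube u v d. F x \<partial>lebesgue_Rd d) / emeasure (lebesgue_Rd d) (cube u v d)"
    unfolding unif using FL
    by (intro nn_integral_uniform_measure) (simp_all add: sets_lebesgue_Rd cube_in_sets)
  finally show ?thesis using uv by (simp add: emeasure_cube)
qed

lemma AE_uniform_in_cube:
  assumes X[measurable]: "X \<in> M \<rightarrow>\<^sub>M borel_Rd d"
    and unif: "distr M (borel_Rd d) X = uniform_measure (lebesgue_Rd d) (cube u v d)" and uv: "u < v"
  shows "AE \<omega> in M. X \<omega> \<in> cube u v d"
proof -
  have "AE x in uniform_measure (lebesgue_Rd d) (cube u v d). x \<in> cube u v d"
    using uv by (intro AE_uniform_measureI) (simp_all add: sets_lebesgue_Rd cube_in_sets)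
  then have "AE x in distr M (borel_Rd d) X. x \<in> cube u v d" unfolding unif .
  moreover have "{x \<in> space (borel_Rd d). x \<in> cube u v d} \<in> sets (borel_Rd d)"
    by measurable
  ultimately show ?thesis by (subst (asm) AE_distr_iff) auto
qed

text \<open>The constants in the sample size condition: \<open>K\<close> is the truncation level of \<open>\<phi>\<close>, and the sum
  added to \<open>4 / \<rho>\<close> is the metric entropy of the network class at scale \<open>\<epsilon> / (64 * (B + K))\<close>.\<close>

lemma erm_error_bound:
  fixes \<phi> fT :: "(nat \<Rightarrow> real) \<Rightarrow> real" and X Y :: "'a \<Rightarrow> nat \<Rightarrow> real"
    and xs ys :: "nat \<Rightarrow> 'a \<Rightarrow> nat \<Rightarrow> real" and e :: "'a \<Rightarrow> (nat \<Rightarrow> real) \<Rightarrow> real"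
  assumes uv: "u < v"
    and fT[measurable]: "fT \<in> borel_measurable (borel_Rd d)"
    and \<phi>[measurable]: "\<phi> \<in> borel_measurable (borel_Rd d)"
    and X[measurable]: "X \<in> M \<rightarrow>\<^sub>M borel_Rd d" and Y[measurable]: "Y \<in> M \<rightarrow>\<^sub>M borel_Rd d"
    and unif: "distr M (borel_Rd d) X = uniform_measure (lebesgue_Rd d) (cube u v d)"
    and indep: "indep_vars (\<lambda>_. borel_Rd d \<Otimes>\<^sub>M borel_Rd d) (\<lambda>i \<omega>. (xs i \<omega>, ys i \<omega>)) {1..}"
    and distr: "\<And>i. i \<ge> 1 \<Longrightarrow>
        distr M (borel_Rd d \<Otimes>\<^sub>M borel_Rd d) (\<lambda>\<omega>. (xs i \<omega>, ys i \<omega>))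
          = distr M (borel_Rd d \<Otimes>\<^sub>M borel_Rd d) (\<lambda>\<omega>. (X \<omega>, Y \<omega>))"
    and risk_min: "\<And>g. g \<in> borel_measurable (borel_Rd d) \<Longrightarrow>
        (\<integral>\<^sup>+ x \<in> cube u v d. ennreal ((g x)\<^sup>2) \<partial>lebesgue_Rd d) < \<infinity> \<Longrightarrow>
          integrable M (\<lambda>\<omega>. (g (X \<omega>) - \<phi> (Y \<omega>))\<^sup>2) \<and>
          (\<integral>\<omega>. (fT (X \<omega>) - \<phi> (Y \<omega>))\<^sup>2 \<partial>M) \<le> (\<integral>\<omega>. (g (X \<omega>) - \<phi> (Y \<omega>))\<^sup>2 \<partial>M)"
    and e_in: "\<And>\<omega>. \<omega> \<in> space M \<Longrightarrow> e \<omega> \<in> NN u v d a R D"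
    and e_min: "\<And>\<omega> g. \<omega> \<in> space M \<Longrightarrow> g \<in> NN u v d a R D \<Longrightarrow>
        emp_risk \<phi> xs ys m (e \<omega>) \<omega> \<le> emp_risk \<phi> xs ys m g \<omega>"
    and e_meas: "\<And>x. x \<in> cube u v d \<Longrightarrow> (\<lambda>\<omega>. e \<omega> x) \<in> borel_measurable M"
    and a: "is_arch a d" and R: "0 < R" "R \<le> B" and D: "0 < D" "D \<le> B" and B: "1 \<le> B"
    and P: "real (num_params a) \<le> B" and U: "1 \<le> U" "\<bar>u\<bar> \<le> U" "\<bar>v\<bar> \<le> U"
    and g0: "g0 \<in> NN u v d a R D" "l2err u v d g0 fT \<le> ennreal (\<epsilon> / 2)"
    and S: "1 \<le> S" "expectation (\<lambda>\<omega>. (\<phi> (Y \<omega>))\<^sup>2) \<le> S"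
    and \<epsilon>: "0 < \<epsilon>" and \<rho>: "0 < \<rho>" "\<rho> < 1" and m: "1 \<le> m"
    and K: "K = 64 * B * S * (1 / \<epsilon>) * (1 / \<rho>)"
    and m_large: "512 * (B\<^sup>2 + 2 * B * K)\<^sup>2 * (1 / \<epsilon>)\<^sup>2 *
        (2 * B ^ 4 + 128 * B ^ 3 * U * (B + K) * (1 / \<epsilon>) + 4 * (1 / \<rho>)) \<le> real m"
  shows "1 - \<rho> \<le> prob {\<omega> \<in> space M. l2err u v d (e \<omega>) fT \<le> ennreal \<epsilon>}"
proof -
  let ?N = "borel_Rd d \<Otimes>\<^sub>M borel_Rd d" and ?H = "clipped_nns u v d a R D"
  define Z0 where "Z0 = (\<lambda>\<omega>. (X \<omega>, Y \<omega>))"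
  define Z where "Z = (\<lambda>i \<omega>. (xs i \<omega>, ys i \<omega>))"
  define \<Phi> where "\<Phi> = (\<lambda>z :: (nat \<Rightarrow> real) \<times> (nat \<Rightarrow> real). \<phi> (snd z))"
  define lift where "lift = (\<lambda>h (z :: (nat \<Rightarrow> real) \<times> (nat \<Rightarrow> real)). h (fst z) :: real)"
  have Z0[measurable]: "Z0 \<in> M \<rightarrow>\<^sub>M ?N" unfolding Z0_def by measurable
  have Zi: "indep_vars (\<lambda>_. ?N) Z {1..m}"
    unfolding Z_def using indep by (rule indep_vars_subset) auto
  have Zd: "distr M ?N (Z i) = distr M ?N Z0" if "i \<in> {1..m}" for i
    unfolding Z_def Z0_def using distr that by simp
  have Zm: "Z i \<in> M \<rightarrow>\<^sub>M ?N" if "i \<in> {1..m}" for i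
    using Zi that unfolding indep_vars_def by blast
  have \<Phi>[measurable]: "\<Phi> \<in> borel_measurable ?N" unfolding \<Phi>_def by measurable
  have Hm: "h \<in> borel_measurable (borel_Rd d)" if "h \<in> ?H" for h
    using clipped_nns_measurable[OF that a] .
  have Hb: "\<bar>h x\<bar> \<le> D" if "h \<in> ?H" for h x using clipped_nns_bounded[OF that] D by simp
  have l2: "l2err u v d g h = (\<integral>\<^sup>+ \<omega>. ennreal ((g (X \<omega>) - h (X \<omega>))\<^sup>2) \<partial>M)"
    if [measurable]: "g \<in> borel_measurable (borel_Rd d)" "h \<in> borel_measurable (borel_Rd d)" for g h
    unfolding l2err_def by (rule nn_integral_uniform_cube[OF X unif uv, symmetric]) measurable
  \<comment> \<open>Minimality is available only against functions square integrable over the cube.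
    This transfers integrability under the law of \<open>X\<close> back to Lebesgue measure, for the
    competitors on the line through \<open>fT\<close> and \<open>h\<close>.\<close>
  have sqi: "(\<integral>\<^sup>+ x \<in> cube u v d. ennreal ((h x)\<^sup>2) \<partial>lebesgue_Rd d) < \<infinity>"
    if [measurable]: "h \<in> borel_measurable (borel_Rd d)" and i: "integrable M (\<lambda>\<omega>. (h (X \<omega>))\<^sup>2)" for h
  proof (rule ccontr)
    assume "\<not> ?thesis"
    then have "(\<integral>\<^sup>+ x \<in> cube u v d. ennreal ((h x)\<^sup>2) \<partial>lebesgue_Rd d) = \<infinity>"
      by (metis infinity_ennreal_def top.not_eq_extremum)
    moreover have "(\<integral>\<^sup>+ \<omega>. ennreal ((h (X \<omega>))\<^sup>2) \<partial>M)
        = (\<integral>\<^sup>+ x \<in> cube u v d. ennreal ((h x)\<^sup>2) \<partial>lebesgue_Rd d) / ennreal ((v - u) ^ d)"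
      by (rule nn_integral_uniform_cube[OF X unif uv]) measurable
    ultimately have "(\<integral>\<^sup>+ \<omega>. ennreal ((h (X \<omega>))\<^sup>2) \<partial>M) = \<infinity>"
      by (simp add: ennreal_top_divide)
    moreover have "(\<integral>\<^sup>+ \<omega>. ennreal ((h (X \<omega>))\<^sup>2) \<partial>M) = ennreal (expectation (\<lambda>\<omega>. (h (X \<omega>))\<^sup>2))"
      using i by (intro nn_integral_eq_integral) auto
    ultimately show False by simp
  qed
  have Hi: "integrable M (\<lambda>\<omega>. (h (X \<omega>))\<^sup>2)" if h: "h \<in> ?H" for h
  proof (rule integrable_const_bound[where B="D\<^sup>2"])
    have [measurable]: "h \<in> borel_measurable (borel_Rd d)" using Hm[OF h] .
    show "(\<lambda>\<omega>. (h (X \<omega>))\<^sup>2) \<in> borel_measurable M" by measurable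
    show "AE \<omega> in M. norm ((h (X \<omega>))\<^sup>2) \<le> D\<^sup>2"
      using power_mono[OF Hb[OF h], where n=2] by (intro AE_I2) simp
  qed
  have \<phi>i: "integrable M (\<lambda>\<omega>. (\<phi> (Y \<omega>))\<^sup>2)"
    using risk_min[of "\<lambda>_. 0"] by simp
  obtain h0 where h0: "h0 \<in> ?H" "\<And>x. x \<in> cube u v d \<Longrightarrow> g0 x = h0 x" using NN_extend[OF g0(1)] by metis
  have [measurable]: "h0 \<in> borel_measurable (borel_Rd d)" using Hm[OF h0(1)] .
  have "l2err u v d g0 fT = l2err u v d h0 fT" using h0(2) by (rule l2err_cong)
  also have "\<dots> = (\<integral>\<^sup>+ \<omega>. ennreal ((h0 (X \<omega>) - fT (X \<omega>))\<^sup>2) \<partial>M)" by (rule l2) measurable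
  finally have nn0: "(\<integral>\<^sup>+ \<omega>. ennreal ((h0 (X \<omega>) - fT (X \<omega>))\<^sup>2) \<partial>M) \<le> ennreal (\<epsilon> / 2)"
    using g0(2) by simp
  have i0: "integrable M (\<lambda>\<omega>. (h0 (X \<omega>) - fT (X \<omega>))\<^sup>2)"
    using order_le_less_trans[OF nn0] by (intro integrableI_nonneg) auto
  have e0: "expectation (\<lambda>\<omega>. (h0 (X \<omega>) - fT (X \<omega>))\<^sup>2) \<le> \<epsilon> / 2"
    using nn0 \<epsilon> by (subst (asm) nn_integral_eq_integral[OF i0]) (auto simp: ennreal_le_iff)
  \<comment> \<open>\<open>fT\<close> inherits square integrability from the bounded network
    \<open>h0\<close> at finite L2 distance; the inequality used is a rearrangement of (2 h0 - fT)^2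
    \<ge> 0.\<close>
  have fTi: "integrable M (\<lambda>\<omega>. (fT (X \<omega>))\<^sup>2)"
  proof (rule Bochner_Integration.integrable_bound)
    show "integrable M (\<lambda>\<omega>. 2 * (h0 (X \<omega>) - fT (X \<omega>))\<^sup>2 + 2 * (h0 (X \<omega>))\<^sup>2)"
      using i0 Hi[OF h0(1)] by simp
    show "AE \<omega> in M. norm ((fT (X \<omega>))\<^sup>2) \<le> norm (2 * (h0 (X \<omega>) - fT (X \<omega>))\<^sup>2 + 2 * (h0 (X \<omega>))\<^sup>2)"
    proof (rule AE_I2)
      fix \<omega>
      have "0 \<le> (2 * h0 (X \<omega>) - fT (X \<omega>))\<^sup>2" by simp
      also have "\<dots> = 2 * (h0 (X \<omega>) - fT (X \<omega>))\<^sup>2 + 2 * (h0 (X \<omega>))\<^sup>2 - (fT (X \<omega>))\<^sup>2"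
        by (simp add: power2_eq_square algebra_simps)
      finally show "norm ((fT (X \<omega>))\<^sup>2) \<le> norm (2 * (h0 (X \<omega>) - fT (X \<omega>))\<^sup>2 + 2 * (h0 (X \<omega>))\<^sup>2)"
        by simp
    qed
  qed measurable
  \<comment> \<open>The gap between excess risk and squared L2 distance; it is the same for every
    network and cancels when \<open>h\<close> is compared with \<open>h0\<close>.\<close>
  define c where "c = expectation (\<lambda>\<omega>. (\<phi> (Y \<omega>))\<^sup>2) - expectation (\<lambda>\<omega>. (fT (X \<omega>) - \<phi> (Y \<omega>))\<^sup>2)"
  have pyth: "integrable M (\<lambda>\<omega>. (h (X \<omega>) - fT (X \<omega>))\<^sup>2) \<and> expectation (\<lambda>\<omega>. (h (X \<omega>) - fT (X \<omega>))\<^sup>2)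
      = expectation (\<lambda>\<omega>. sq_excess \<Phi> (lift h) (Z0 \<omega>)) + c" if h: "h \<in> ?H" for h
  proof -
    have [measurable]: "h \<in> borel_measurable (borel_Rd d)" using Hm[OF h] .
    have hf: "integrable M (\<lambda>\<omega>. (h (X \<omega>) - fT (X \<omega>))\<^sup>2)"
      using Hi[OF h] fTi by (intro integrable_diff_square) measurable
    have "expectation (\<lambda>\<omega>. (h (X \<omega>) - \<phi> (Y \<omega>))\<^sup>2)
      = expectation (\<lambda>\<omega>. (fT (X \<omega>) - \<phi> (Y \<omega>))\<^sup>2) + expectation (\<lambda>\<omega>. (h (X \<omega>) - fT (X \<omega>))\<^sup>2)"
    proof (rule minimizer_pythagoras)
      show "(\<lambda>\<omega>. fT (X \<omega>)) \<in> borel_measurable M" "(\<lambda>\<omega>. h (X \<omega>)) \<in> borel_measurable M"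
        "(\<lambda>\<omega>. \<phi> (Y \<omega>)) \<in> borel_measurable M" by measurable
      fix t :: real
      have "integrable M (\<lambda>\<omega>. (fT (X \<omega>))\<^sup>2 + 2 * t * (fT (X \<omega>) * (h (X \<omega>) - fT (X \<omega>)))
          + t\<^sup>2 * (h (X \<omega>) - fT (X \<omega>))\<^sup>2)"
        using fTi hf integrable_mult_of_square[of "\<lambda>\<omega>. fT (X \<omega>)" "\<lambda>\<omega>. h (X \<omega>) - fT (X \<omega>)"] by simp
      also have "(\<lambda>\<omega>. (fT (X \<omega>))\<^sup>2 + 2 * t * (fT (X \<omega>) * (h (X \<omega>) - fT (X \<omega>)))
          + t\<^sup>2 * (h (X \<omega>) - fT (X \<omega>))\<^sup>2) = (\<lambda>\<omega>. (fT (X \<omega>) + t * (h (X \<omega>) - fT (X \<omega>)))\<^sup>2)"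
        by (simp add: fun_eq_iff power2_eq_square algebra_simps)
      finally have i: "integrable M (\<lambda>\<omega>. (fT (X \<omega>) + t * (h (X \<omega>) - fT (X \<omega>)))\<^sup>2)" .
      have "(\<lambda>x. fT x + t * (h x - fT x)) \<in> borel_measurable (borel_Rd d)" by measurable
      from risk_min[OF this sqi[OF this i]]
      show "expectation (\<lambda>\<omega>. (fT (X \<omega>) - \<phi> (Y \<omega>))\<^sup>2)
        \<le> expectation (\<lambda>\<omega>. (fT (X \<omega>) + t * (h (X \<omega>) - fT (X \<omega>)) - \<phi> (Y \<omega>))\<^sup>2)" by simp
    qed (fact fTi Hi[OF h] \<phi>i)+
    moreover have "expectation (\<lambda>\<omega>. (h (X \<omega>) - \<phi> (Y \<omega>))\<^sup>2)
      = expectation (\<lambda>\<omega>. sq_excess \<Phi> (lift h) (Z0 \<omega>)) + expectation (\<lambda>\<omega>. (\<phi> (Y \<omega>))\<^sup>2)"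
    proof -
      have "integrable M (\<lambda>\<omega>. h (X \<omega>) * \<phi> (Y \<omega>))"
        using Hi[OF h] \<phi>i by (intro integrable_mult_of_square) measurable
      then have "integrable M (\<lambda>\<omega>. sq_excess \<Phi> (lift h) (Z0 \<omega>))"
        using Hi[OF h] by (simp add: sq_excess_def \<Phi>_def lift_def Z0_def mult.assoc)
      then have "expectation (\<lambda>\<omega>. sq_excess \<Phi> (lift h) (Z0 \<omega>)) + expectation (\<lambda>\<omega>. (\<phi> (Y \<omega>))\<^sup>2)
        = expectation (\<lambda>\<omega>. sq_excess \<Phi> (lift h) (Z0 \<omega>) + (\<phi> (Y \<omega>))\<^sup>2)" using \<phi>i by simp
      also have "(\<lambda>\<omega>. sq_excess \<Phi> (lift h) (Z0 \<omega>) + (\<phi> (Y \<omega>))\<^sup>2) = (\<lambda>\<omega>. (h (X \<omega>) - \<phi> (Y \<omega>))\<^sup>2)"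
        by (simp add: fun_eq_iff sq_excess_def \<Phi>_def lift_def Z0_def power2_diff)
      finally show ?thesis by simp
    qed
    ultimately show ?thesis using hf unfolding c_def by simp
  qed

  have BS: "1 \<le> B * S" using B S(1) mult_mono[of 1 B 1 S] by simp
  have K0: "0 < K" unfolding K using BS \<epsilon> \<rho> by (simp add: mult.assoc)
  \<comment> \<open>Chosen so that \<open>4 * \<eta> * (B + K)\<close>, the cost of passing to the
    net, is \<epsilon>/16.\<close>
  define \<eta> where "\<eta> = \<epsilon> / (64 * (B + K))"
  have \<eta>: "0 < \<eta>" unfolding \<eta>_def using \<epsilon> B K0 by simp
  define \<Lambda> where "\<Lambda> = 2 * B ^ 4 + 128 * B ^ 3 * U * (B + K) * (1 / \<epsilon>)"
  obtain F where F: "finite F" "F \<subseteq> ?H" "real (card F) \<le> exp (2 * B ^ 4 + 2 * B ^ 3 * U / \<eta>)"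
    "\<And>h. h \<in> ?H \<Longrightarrow> \<exists>h'\<in>F. \<forall>x. \<bar>h x - h' x\<bar> \<le> \<eta>"
    using clipped_nns_cover[OF a R D(1) B P U \<eta>] by blast
  have "2 * B ^ 3 * U / \<eta> = 128 * B ^ 3 * U * (B + K) * (1 / \<epsilon>)" by (simp add: \<eta>_def)
  then have cF: "real (card F) \<le> exp \<Lambda>" using F(3) by (simp add: \<Lambda>_def)
  \<comment> \<open>This \<open>s\<close> produces the constant 512 = 2 * 16^2 in
    \<open>m_large\<close>. The next choice, t = 2 S/\<rho>, makes Markov's share S/t equal to
    \<rho>/2, and \<open>K\<close> is fitted to it: 2 B t/K = \<epsilon>/16.\<close>
  define s where "s = \<epsilon> / 16"
  define t where "t = 2 * S / \<rho>"
  have t0: "0 < t" using S \<rho> by (simp add: t_def)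
  obtain E where E: "E \<in> events"
    "prob E \<ge> 1 - (2 * real (card (lift ` F)) * exp (- (m * s\<^sup>2) / (2 * (D\<^sup>2 + 2 * D * K)\<^sup>2)) + S / t)"
    "\<And>\<omega> g. \<omega> \<in> E \<Longrightarrow> g \<in> lift ` ?H \<Longrightarrow>
      \<bar>(\<Sum>i=1..m. sq_excess \<Phi> g (Z i \<omega>)) / m - expectation (\<lambda>\<omega>. sq_excess \<Phi> g (Z0 \<omega>))\<bar>
        \<le> s + 4 * \<eta> * (D + K) + 2 * D * (t / K) + 2 * D * (S / K)"
  proof (rule truncated_uniform_deviation[where N="?N" and Z=Z and ?Z0.0=Z0 and F="lift ` F" and H="lift ` ?H"
        and D=D and \<eta>=\<eta> and \<phi>=\<Phi> and S=S and K=K and s=s and t=t and m=m])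
    show "g \<in> borel_measurable ?N" if "g \<in> lift ` ?H" for g
    proof -
      obtain h where h: "h \<in> ?H" "g = lift h" using \<open>g \<in> lift ` ?H\<close> by blast
      have [measurable]: "h \<in> borel_measurable (borel_Rd d)" using Hm[OF h(1)] .
      show ?thesis unfolding h(2) lift_def by measurable
    qed
    show "\<bar>g z\<bar> \<le> D" if "g \<in> lift ` ?H" for g z using that Hb by (auto simp: lift_def)
    show "\<exists>g'\<in>lift ` F. \<forall>z. \<bar>g z - g' z\<bar> \<le> \<eta>" if "g \<in> lift ` ?H" for g
      using that F(4) by (fastforce simp: lift_def)
    show "integrable M (\<lambda>\<omega>. (\<Phi> (Z0 \<omega>))\<^sup>2)" "expectation (\<lambda>\<omega>. (\<Phi> (Z0 \<omega>))\<^sup>2) \<le> S"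
      using \<phi>i S(2) by (simp_all add: \<Phi>_def Z0_def)
  qed (use Zi Z0 Zd F(1,2) D K0 \<epsilon> t0 m in \<open>auto simp: s_def\<close>)

  have "1 - \<rho> \<le> prob E"
  proof -
    have "real (card (lift ` F)) \<le> exp \<Lambda>"
      using card_image_le[OF F(1), of lift] cF by linarith
    moreover have "exp (- (m * s\<^sup>2) / (2 * (D\<^sup>2 + 2 * D * K)\<^sup>2)) \<le> exp (- (\<Lambda> + 4 * (1 / \<rho>)))"
    proof -
      \<comment> \<open>\<open>m_large\<close> is phrased with the bound \<open>B\<close> in place
        of \<open>D\<close>, so that the required sample size is determined by d, \<epsilon> and
        \<rho> and not by the particular class; passing from \<open>D\<close> to \<open>B\<close>
        only enlarges the range of the loss.\<close>
      let ?b = "D\<^sup>2 + 2 * D * K" and ?b' = "B\<^sup>2 + 2 * B * K"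
      have b: "0 < ?b" using D K0 by (simp add: add_pos_pos)
      have "?b \<le> ?b'" using D K0 by (intro add_mono power_mono mult_mono) auto
      then have bb: "?b\<^sup>2 \<le> ?b'\<^sup>2" using b by (intro power_mono) auto
      have L0: "0 \<le> \<Lambda> + 4 * (1 / \<rho>)" unfolding \<Lambda>_def using B U K0 \<epsilon> \<rho> by simp
      have "(\<Lambda> + 4 * (1 / \<rho>)) * (2 * ?b\<^sup>2) \<le> (\<Lambda> + 4 * (1 / \<rho>)) * (2 * ?b'\<^sup>2)"
        using bb L0 by (intro mult_left_mono) auto
      also have "\<dots> = 512 * ?b'\<^sup>2 * (1 / \<epsilon>)\<^sup>2 * (\<Lambda> + 4 * (1 / \<rho>)) * s\<^sup>2"
        using \<epsilon> by (simp add: s_def power_divide)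
      also have "\<dots> \<le> real m * s\<^sup>2"
        using m_large by (intro mult_right_mono) (simp_all add: \<Lambda>_def)
      finally have "\<Lambda> + 4 * (1 / \<rho>) \<le> (m * s\<^sup>2) / (2 * ?b\<^sup>2)"
        using b by (subst pos_le_divide_eq) auto
      then show ?thesis by simp
    qed
    ultimately have "2 * real (card (lift ` F)) * exp (- (m * s\<^sup>2) / (2 * (D\<^sup>2 + 2 * D * K)\<^sup>2))
        \<le> 2 * exp \<Lambda> * exp (- (\<Lambda> + 4 * (1 / \<rho>)))" by (intro mult_mono) auto
    also have "\<dots> = 2 * exp (- (4 * (1 / \<rho>)))" by (simp add: exp_add[symmetric] mult.assoc)
    \<comment> \<open>The \<Lambda> in the exponent has absorbed the size of the net. What is left
      is a bare exponential in 4/\<rho>, and w \<le> exp w at w = 4/\<rho> suffices.\<close>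
    also have "\<dots> \<le> \<rho> / 2"
    proof -
      have "4 / \<rho> \<le> exp (4 / \<rho>)" using exp_ge_add_one_self[of "4 / \<rho>"] by linarith
      then show ?thesis using \<rho> by (simp add: exp_minus field_simps)
    qed
    finally have "2 * real (card (lift ` F)) * exp (- (m * s\<^sup>2) / (2 * (D\<^sup>2 + 2 * D * K)\<^sup>2)) \<le> \<rho> / 2" .
    moreover have "S / t = \<rho> / 2" using S \<rho> by (simp add: t_def)
    ultimately show ?thesis using E(2) by linarith
  qed
  also have "prob E \<le> prob {\<omega> \<in> space M. l2err u v d (e \<omega>) fT \<le> ennreal \<epsilon>}"
  proof (rule finite_measure_mono_AE)
    have [measurable]: "(\<lambda>\<omega>. l2err u v d (e \<omega>) fT) \<in> borel_measurable M"
      using e_meas NN_lipschitz[OF e_in a] D fT by (intro l2err_caratheodory_measurable) auto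
    show "{\<omega> \<in> space M. l2err u v d (e \<omega>) fT \<le> ennreal \<epsilon>} \<in> events" by measurable
    \<comment> \<open>The minimizer and its extension by zero agree on the cube only, so their
      empirical risks coincide once all sample points lie there. This holds almost surely, hence the
      inclusion of events up to a null set.\<close>
    have xc: "AE \<omega> in M. xs i \<omega> \<in> cube u v d" if i: "i \<in> {1..m}" for i
    proof (rule AE_uniform_in_cube)
      have xm: "xs i = (\<lambda>\<omega>. fst (Z i \<omega>))" by (simp add: Z_def)
      show "xs i \<in> M \<rightarrow>\<^sub>M borel_Rd d" unfolding xm using Zm[OF i] by (rule measurable_compose) measurable
      have "distr M (borel_Rd d) (xs i) = distr (distr M ?N (Z i)) (borel_Rd d) fst"
        unfolding xm using distr_distr[OF measurable_fst Zm[OF i]] by (simp add: comp_def)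
      also have "\<dots> = distr M (borel_Rd d) X"
        unfolding Zd[OF i] using distr_distr[OF measurable_fst Z0] by (simp add: comp_def Z0_def)
      finally show "distr M (borel_Rd d) (xs i) = uniform_measure (lebesgue_Rd d) (cube u v d)"
        by (simp add: unif)
    qed (rule uv)
    then have "AE \<omega> in M. \<forall>i\<in>{1..m}. xs i \<omega> \<in> cube u v d" by (intro AE_finite_allI) auto
    then show "AE \<omega> in M. \<omega> \<in> E \<longrightarrow> \<omega> \<in> {\<omega> \<in> space M. l2err u v d (e \<omega>) fT \<le> ennreal \<epsilon>}"
    proof (rule AE_mp[OF _ AE_I2], intro impI)
      fix \<omega> assume \<omega>: "\<omega> \<in> space M" and cube: "\<forall>i\<in>{1..m}. xs i \<omega> \<in> cube u v d" and \<omega>E: "\<omega> \<in> E"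
      define em where "em = (\<lambda>h. (\<Sum>i=1..m. sq_excess \<Phi> (lift h) (Z i \<omega>)) / real m)"
      define ex where "ex = (\<lambda>h. expectation (\<lambda>\<omega>. sq_excess \<Phi> (lift h) (Z0 \<omega>)))"
      obtain h where h: "h \<in> ?H" "\<And>x. x \<in> cube u v d \<Longrightarrow> e \<omega> x = h x" using NN_extend[OF e_in[OF \<omega>]] by metis
      have [measurable]: "h \<in> borel_measurable (borel_Rd d)" using Hm[OF h(1)] .
      have emp: "emp_risk \<phi> xs ys m g \<omega> = em h + (\<Sum>i=1..m. (\<phi> (ys i \<omega>))\<^sup>2) / real m"
        if gh: "\<And>x. x \<in> cube u v d \<Longrightarrow> g x = h x" for g h
      proof -
        have "(\<Sum>i=1..m. (g (xs i \<omega>) - \<phi> (ys i \<omega>))\<^sup>2)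
          = (\<Sum>i=1..m. sq_excess \<Phi> (lift h) (Z i \<omega>) + (\<phi> (ys i \<omega>))\<^sup>2)"
          using cube gh
          by (intro sum.cong refl) (simp add: sq_excess_def \<Phi>_def lift_def Z_def power2_diff)
        then show ?thesis by (simp add: emp_risk_def em_def sum.distrib add_divide_distrib)
      qed
      have le: "em h \<le> em h0"
        using e_min[OF \<omega> g0(1)] emp[OF h(2)] emp[OF h0(2)] by simp
      define r where "r = s + 4 * \<eta> * (D + K) + 2 * D * (t / K) + 2 * D * (S / K)"
      have dev: "\<bar>em h - ex h\<bar> \<le> r" "\<bar>em h0 - ex h0\<bar> \<le> r"
        using E(3)[OF \<omega>E] h(1) h0(1) by (auto simp: em_def ex_def r_def)
      have r: "r \<le> \<epsilon> / 4"
      proof -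
        have "4 * \<eta> * (D + K) \<le> 4 * \<eta> * (B + K)" using D \<eta> by (intro mult_left_mono) auto
        also have "\<dots> = \<epsilon> / 16"
        proof -
          have "4 * (\<epsilon> / (64 * w)) * w = \<epsilon> / 16" if "0 < w" for w :: real
            using that by (simp add: field_simps)
          from this[of "B + K"] show ?thesis unfolding \<eta>_def using B K0 by linarith
        qed
        finally have 1: "4 * \<eta> * (D + K) \<le> \<epsilon> / 16" .
        have "2 * D * (t / K) \<le> 2 * B * (t / K)" using D t0 K0 by (intro mult_right_mono) auto
        also have "\<dots> = \<epsilon> / 16" using B S \<epsilon> \<rho> by (simp add: t_def K field_simps)
        finally have 2: "2 * D * (t / K) \<le> \<epsilon> / 16" .
        have "2 * D * (S / K) \<le> 2 * B * (S / K)" using D S K0 by (intro mult_right_mono) auto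
        also have "\<dots> = \<epsilon> * \<rho> / 32" using B S \<epsilon> \<rho> by (simp add: K field_simps)
        also have "\<dots> \<le> \<epsilon> / 32" using \<epsilon> \<rho> by (simp add: mult_left_le)
        finally have 3: "2 * D * (S / K) \<le> \<epsilon> / 32" .
        show ?thesis unfolding r_def s_def using 1 2 3 \<epsilon> by linarith
      qed
      \<comment> \<open>From true risk of \<open>h\<close> to its empirical risk, to that of
        \<open>h0\<close>, to the true risk of \<open>h0\<close>: the squared distance grows by at
        most 2 r \<le> \<epsilon>/2 over that of \<open>h0\<close>, which is itself at most
        \<epsilon>/2.\<close>
      have "expectation (\<lambda>\<omega>. (h' (X \<omega>) - fT (X \<omega>))\<^sup>2) = ex h' + c" if "h' \<in> ?H" for h'
        using pyth[OF that] by (simp add: ex_def)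
      from this[OF h(1)] this[OF h0(1)]
      have "expectation (\<lambda>\<omega>. (h (X \<omega>) - fT (X \<omega>))\<^sup>2) \<le> \<epsilon>"
        using e0 dev le r by linarith
      moreover have "l2err u v d (e \<omega>) fT = l2err u v d h fT" using h(2) by (rule l2err_cong)
      moreover have "\<dots> = (\<integral>\<^sup>+ \<omega>. ennreal ((h (X \<omega>) - fT (X \<omega>))\<^sup>2) \<partial>M)" by (rule l2) measurable
      moreover have "\<dots> = ennreal (expectation (\<lambda>\<omega>. (h (X \<omega>) - fT (X \<omega>))\<^sup>2))"
        using pyth[OF h(1)] by (intro nn_integral_eq_integral) auto
      ultimately show "\<omega> \<in> {\<omega> \<in> space M. l2err u v d (e \<omega>) fT \<le> ennreal \<epsilon>}"
        using \<omega> by (simp add: ennreal_leI)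
    qed
  qed
  finally show ?thesis .
qed

end

section \<open>Choice of the polynomials, uniformly in the dimension\<close>

theorem theorem3p16:
  fixes M :: "'w measure"
    and T u v c1 c2 lam :: real
    and f :: "nat \<Rightarrow> (nat \<Rightarrow> real) \<Rightarrow> real \<Rightarrow> real"
    and \<phi> :: "nat \<Rightarrow> (nat \<Rightarrow> real) \<Rightarrow> real"
    and X Y :: "nat \<Rightarrow> 'w \<Rightarrow> nat \<Rightarrow> real"
    and xs ys :: "nat \<Rightarrow> nat \<Rightarrow> 'w \<Rightarrow> nat \<Rightarrow> real"
    and erm :: "nat \<Rightarrow> nat \<Rightarrow> nat list \<Rightarrow> real \<Rightarrow> real \<Rightarrow> 'w \<Rightarrow> (nat \<Rightarrow> real) \<Rightarrow> real"
    and q0 :: "real \<Rightarrow> real \<Rightarrow> real"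
  assumes M: "prob_space M"
    and T: "0 < T" and uv: "u < v"
    \<comment> \<open>f_d is continuous on R^d x [0,T]; phi_d is Borel measurable\<close>
    and f_cont: "\<And>d. d \<ge> 1 \<Longrightarrow> continuous_on (Rd d \<times> {0..T}) (\<lambda>(x, t). f d x t)"
    and phi_meas: "\<And>d. d \<ge> 1 \<Longrightarrow> \<phi> d \<in> borel_measurable (borel_Rd d)"
    \<comment> \<open>X_d uniform on [u,v]^d, Y_d a random vector in R^d\<close>
    and X_meas: "\<And>d. d \<ge> 1 \<Longrightarrow> X d \<in> M \<rightarrow>\<^sub>M borel_Rd d"
    and Y_meas: "\<And>d. d \<ge> 1 \<Longrightarrow> Y d \<in> M \<rightarrow>\<^sub>M borel_Rd d"
    and X_unif: "\<And>d. d \<ge> 1 \<Longrightarrow>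
        distr M (borel_Rd d) (X d) = uniform_measure (lebesgue_Rd d) (cube u v d)"
    \<comment> \<open>(x_i, y_i), i \<ge> 1, are i.i.d. copies of (X_d, Y_d)\<close>
    and iid_indep: "\<And>d. d \<ge> 1 \<Longrightarrow>
        prob_space.indep_vars M (\<lambda>_. borel_Rd d \<Otimes>\<^sub>M borel_Rd d)
          (\<lambda>i \<omega>. (xs d i \<omega>, ys d i \<omega>)) {1..}"
    and iid_distr: "\<And>d i. d \<ge> 1 \<Longrightarrow> i \<ge> 1 \<Longrightarrow>
        distr M (borel_Rd d \<Otimes>\<^sub>M borel_Rd d) (\<lambda>\<omega>. (xs d i \<omega>, ys d i \<omega>))
          = distr M (borel_Rd d \<Otimes>\<^sub>M borel_Rd d) (\<lambda>\<omega>. (X d \<omega>, Y d \<omega>))"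
    \<comment> \<open>standing assumption: the risk is real-valued on L2([u,v]^d) and f_d(.,T) minimises it\<close>
    and risk_min: "\<And>d g. d \<ge> 1 \<Longrightarrow> g \<in> borel_measurable (borel_Rd d) \<Longrightarrow>
        (\<integral>\<^sup>+ x \<in> cube u v d. ennreal ((g x)\<^sup>2) \<partial>lebesgue_Rd d) < \<infinity> \<Longrightarrow>
          integrable M (\<lambda>\<omega>. (g (X d \<omega>) - \<phi> d (Y d \<omega>))\<^sup>2) \<and>
          (\<integral>\<omega>. (f d (X d \<omega>) T - \<phi> d (Y d \<omega>))\<^sup>2 \<partial>M)
            \<le> (\<integral>\<omega>. (g (X d \<omega>) - \<phi> d (Y d \<omega>))\<^sup>2 \<partial>M)"
    \<comment> \<open>f_{d,m,H}: a measurable minimiser of the empirical risk over H = N_{a,R,D}\<close>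
    and erm_in: "\<And>d m a R D \<omega>. d \<ge> 1 \<Longrightarrow> m \<ge> 1 \<Longrightarrow> is_arch a d \<Longrightarrow> 0 < R \<Longrightarrow> 0 < D \<Longrightarrow>
        \<omega> \<in> space M \<Longrightarrow> erm d m a R D \<omega> \<in> NN u v d a R D"
    and erm_min: "\<And>d m a R D \<omega> g. d \<ge> 1 \<Longrightarrow> m \<ge> 1 \<Longrightarrow> is_arch a d \<Longrightarrow> 0 < R \<Longrightarrow> 0 < D \<Longrightarrow>
        \<omega> \<in> space M \<Longrightarrow> g \<in> NN u v d a R D \<Longrightarrow>
        emp_risk (\<phi> d) (xs d) (ys d) m (erm d m a R D \<omega>) \<omega> \<le> emp_risk (\<phi> d) (xs d) (ys d) m g \<omega>"
    and erm_meas: "\<And>d m a R D x. d \<ge> 1 \<Longrightarrow> m \<ge> 1 \<Longrightarrow> is_arch a d \<Longrightarrow> 0 < R \<Longrightarrow> 0 < D \<Longrightarrow>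
        x \<in> cube u v d \<Longrightarrow> (\<lambda>\<omega>. erm d m a R D \<omega> x) \<in> borel_measurable M"
    \<comment> \<open>condition (i)\<close>
    and cond_i: "0 < c1" "\<And>d t i. d \<ge> 1 \<Longrightarrow> 1 \<le> t \<Longrightarrow> i < d \<Longrightarrow>
        measure M {\<omega> \<in> space M. \<bar>Y d \<omega> i\<bar> \<ge> t} \<le> 2 * exp (- c1 * (ln t)\<^sup>2)"
    \<comment> \<open>condition (ii)\<close>
    and cond_ii: "0 < c2" "2 \<le> lam" "\<And>d y. d \<ge> 1 \<Longrightarrow> y \<in> Rd d \<Longrightarrow>
        \<bar>\<phi> d y\<bar> \<le> c2 * (1 + norm2 d y powr lam)"
    \<comment> \<open>condition (iii)\<close>
    and cond_iii: "is_poly2 q0" "\<And>d \<epsilon>. d \<ge> 1 \<Longrightarrow> 0 < \<epsilon> \<Longrightarrow> \<epsilon> < 1 \<Longrightarrow>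
        \<exists>a R D g. is_arch a d \<and> 0 < R \<and> 0 < D \<and> g \<in> NN u v d a R D \<and>
          l2err u v d g (\<lambda>x. f d x T) \<le> ennreal \<epsilon> \<and>
          D \<le> q0 (real d) (1 / \<epsilon>) \<and> R \<le> q0 (real d) (1 / \<epsilon>) \<and>
          real (num_params a) \<le> q0 (real d) (1 / \<epsilon>)"
  shows "\<exists>p q. is_poly3 p \<and> is_poly2 q \<and>
    (\<forall>d \<epsilon> \<rho> m. d \<ge> 1 \<longrightarrow> 0 < \<epsilon> \<longrightarrow> \<epsilon> < 1 \<longrightarrow> 0 < \<rho> \<longrightarrow> \<rho> < 1 \<longrightarrow> m \<ge> 1 \<longrightarrow>
       real m \<ge> p (real d) (1 / \<epsilon>) (1 / \<rho>) \<longrightarrow>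
       (\<exists>a R D. is_arch a d \<and> 0 < R \<and> 0 < D \<and>
          real (num_params a) \<le> q (real d) (1 / \<epsilon>) \<and> R \<le> q (real d) (1 / \<epsilon>) \<and>
          D \<le> q (real d) (1 / \<epsilon>) \<and>
          measure M {\<omega> \<in> space M. l2err u v d (erm d m a R D \<omega>) (\<lambda>x. f d x T) \<le> ennreal \<epsilon>}
            \<ge> 1 - \<rho>))"
proof -
  interpret prob_space M by (rule M)
  obtain A0 n where A0: "0 \<le> A0" "\<And>x y. 1 \<le> x \<Longrightarrow> 1 \<le> y \<Longrightarrow> q0 x y \<le> A0 * x ^ n * y ^ n"
    using poly2_le_monomial[OF cond_iii(1)] by blast
  \<comment> \<open>The factor 2^n pays for using condition (iii) at \<epsilon>/2, that is, at
    2/\<epsilon> in the second argument. The summand 1 ensures q \<ge> 1, as the bound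
    \<open>B\<close> demands.\<close>
  define A where "A = 1 + A0 * 2 ^ n"
  define q where "q = (\<lambda>x y :: real. A * x ^ n * y ^ n)"
  have A: "1 \<le> A" using A0(1) by (simp add: A_def)
  have q1: "1 \<le> q x y" if "1 \<le> x" "1 \<le> y" for x y
    unfolding q_def using A that by (intro one_le_triple_prod one_le_power)
  have q0q: "q0 x (2 * y) \<le> q x y" if "1 \<le> x" "1 \<le> y" for x y
  proof -
    have "q0 x (2 * y) \<le> A0 * x ^ n * (2 * y) ^ n" using that by (intro A0(2)) auto
    also have "\<dots> = (A0 * 2 ^ n) * (x ^ n * y ^ n)" by (simp add: power_mult_distrib)
    also have "\<dots> \<le> A * (x ^ n * y ^ n)" using that by (intro mult_right_mono) (auto simp: A_def)
    finally show ?thesis by (simp add: q_def mult.assoc)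
  qed
  define k where "k = nat \<lceil>lam\<rceil>"
  have k: "lam \<le> real k" unfolding k_def by linarith
  define G where "G = log_gaussian_moment c1 (2 * lam)"
  have G: "1 \<le> G" unfolding G_def using cond_i(1) cond_ii(2) by (intro log_gaussian_moment_ge_1) auto
  define S where "S = (\<lambda>x :: real. 1 + 2 * c2\<^sup>2 * (1 + x ^ k * x * G))"
  define U where "U = 1 + \<bar>u\<bar> + \<bar>v\<bar>"
  define K where "K = (\<lambda>x y z. 64 * q x y * S x * y * z)"
  \<comment> \<open>The sample size condition of \<open>erm_error_bound\<close> with
    \<open>B = q x y\<close>, y = 1/\<epsilon> and z = 1/\<rho>. It is dominated by a single
    monomial, which becomes the polynomial \<open>p\<close>.\<close>
  define P where "P = (\<lambda>x y z. 512 * ((q x y)\<^sup>2 + 2 * q x y * K x y z)\<^sup>2 * y\<^sup>2 *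
        (2 * q x y ^ 4 + 128 * q x y ^ 3 * U * (q x y + K x y z) * y + 4 * z))"
  have "monomial_bounded P"
    unfolding P_def K_def S_def q_def
    by (intro monomial_bounded_intros) (use A G in \<open>auto simp: U_def\<close>)
  then obtain C N where C: "\<And>x y z. 1 \<le> x \<Longrightarrow> 1 \<le> y \<Longrightarrow> 1 \<le> z \<Longrightarrow> P x y z \<le> C * (x * y * z) ^ N"
    unfolding monomial_bounded_def by blast
  define p where "p = (\<lambda>x y z :: real. C * x ^ N * y ^ N * z ^ N)"
  show ?thesis
  proof (intro exI[of _ p] exI[of _ q] conjI allI impI)
    show "is_poly3 p" unfolding p_def by (rule is_poly3_monomial)
    show "is_poly2 q" unfolding q_def by (rule is_poly2_monomial)
    fix d :: nat and \<epsilon> \<rho> :: real and m :: nat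
    assume d: "1 \<le> d" and \<epsilon>: "0 < \<epsilon>" "\<epsilon> < 1" and \<rho>: "0 < \<rho>" "\<rho> < 1" and m: "1 \<le> m"
      and pm: "p (real d) (1 / \<epsilon>) (1 / \<rho>) \<le> real m"
    define x y z where xyz: "x = real d" "y = 1 / \<epsilon>" "z = 1 / \<rho>"
    have ge1: "1 \<le> x" "1 \<le> y" "1 \<le> z" using d \<epsilon> \<rho> by (auto simp: xyz)
    \<comment> \<open>Accuracy \<epsilon>/2 leaves the other half of the error for the deviations;
      nothing chosen here depends on \<rho> or \<open>m\<close>.\<close>
    obtain a R D g where g: "is_arch a d" "0 < R" "0 < D" "g \<in> NN u v d a R D"
      "l2err u v d g (\<lambda>x. f d x T) \<le> ennreal (\<epsilon> / 2)"
      "D \<le> q0 (real d) (1 / (\<epsilon> / 2))" "R \<le> q0 (real d) (1 / (\<epsilon> / 2))"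
      "real (num_params a) \<le> q0 (real d) (1 / (\<epsilon> / 2))"
      using cond_iii(2)[OF d, of "\<epsilon> / 2"] \<epsilon> by auto
    have "q0 (real d) (1 / (\<epsilon> / 2)) \<le> q x y" using q0q[OF ge1(1,2)] by (simp add: xyz)
    with g have bounds: "D \<le> q x y" "R \<le> q x y" "real (num_params a) \<le> q x y" by linarith+
    have \<phi>i: "integrable M (\<lambda>\<omega>. (\<phi> d (Y d \<omega>))\<^sup>2)" using risk_min[OF d, of "\<lambda>_. 0"] by simp
    have "expectation (\<lambda>\<omega>. (\<phi> d (Y d \<omega>))\<^sup>2) \<le> 2 * c2\<^sup>2 * (1 + real d ^ k * real d * G)"
      unfolding G_def using d Y_meas[OF d] phi_meas[OF d] \<phi>i cond_i(1) cond_i(2)[OF d] cond_ii(1) _ k cond_ii(3)[OF d]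
      by (rule second_moment_bound) (use cond_ii(2) in simp_all)
    then have S: "expectation (\<lambda>\<omega>. (\<phi> d (Y d \<omega>))\<^sup>2) \<le> S x" by (simp add: S_def xyz)
    have S1: "1 \<le> S x" unfolding S_def using G ge1 by simp
    have fT: "(\<lambda>x. f d x T) \<in> borel_measurable (borel_Rd d)"
    proof (rule continuous_imp_borel_Rd_measurable)
      have "continuous_on (Rd d) ((\<lambda>(x, t). f d x t) \<circ> (\<lambda>x. (x, T)))"
        using T by (intro continuous_on_compose continuous_on_subset[OF f_cont[OF d]] continuous_intros) auto
      then show "continuous_on (Rd d) (\<lambda>x. f d x T)" by (simp add: comp_def)
    qed
    have "P x y z \<le> C * (x * y * z) ^ N" using C ge1 by blast
    also have "\<dots> = p x y z" by (simp add: p_def power_mult_distrib)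
    also have "\<dots> \<le> real m" using pm by (simp add: xyz)
    finally have Pm: "P x y z \<le> real m" .
    have "1 - \<rho> \<le> prob {\<omega> \<in> space M. l2err u v d (erm d m a R D \<omega>) (\<lambda>x. f d x T) \<le> ennreal \<epsilon>}"
    proof (rule erm_error_bound[where \<phi>="\<phi> d" and fT="\<lambda>x. f d x T" and e="erm d m a R D" and X="X d" and Y="Y d" and xs="xs d" and ys="ys d"
          and B="q x y" and S="S x" and U=U and K="K x y z" and m=m and a=a and R=R and D=D and ?g0.0=g])
      show "512 * ((q x y)\<^sup>2 + 2 * q x y * K x y z)\<^sup>2 * (1 / \<epsilon>)\<^sup>2 *
        (2 * q x y ^ 4 + 128 * q x y ^ 3 * U * (q x y + K x y z) * (1 / \<epsilon>) + 4 * (1 / \<rho>)) \<le> real m"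
        using Pm unfolding P_def by (simp only: xyz)
      show "K x y z = 64 * q x y * S x * (1 / \<epsilon>) * (1 / \<rho>)" by (simp only: K_def xyz)
      show "indep_vars (\<lambda>_. borel_Rd d \<Otimes>\<^sub>M borel_Rd d) (\<lambda>i \<omega>. (xs d i \<omega>, ys d i \<omega>)) {1..}"
        by (rule iid_indep[OF d])
      show "1 \<le> U" "\<bar>u\<bar> \<le> U" "\<bar>v\<bar> \<le> U" by (simp_all add: U_def)
    qed (fact uv fT phi_meas[OF d] X_meas[OF d] Y_meas[OF d] X_unif[OF d] iid_distr[OF d] risk_min[OF d]
        erm_in[OF d m g(1-3)] erm_min[OF d m g(1-3)] erm_meas[OF d m g(1-3)] g bounds q1[OF ge1(1,2)]
        S S1 \<epsilon> \<rho> m)+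
    with g bounds show "\<exists>a R D. is_arch a d \<and> 0 < R \<and> 0 < D \<and>
          real (num_params a) \<le> q (real d) (1 / \<epsilon>) \<and> R \<le> q (real d) (1 / \<epsilon>) \<and>
          D \<le> q (real d) (1 / \<epsilon>) \<and>
          measure M {\<omega> \<in> space M. l2err u v d (erm d m a R D \<omega>) (\<lambda>x. f d x T) \<le> ennreal \<epsilon>}
            \<ge> 1 - \<rho>"
      unfolding xyz by blast
  qed
qed

end
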